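(* Let $M$ be an oriented maximal surface in the Minkowski space $\mathbb E^4_1$. Then the Gauss map $\nu$ of $M$ is harmonic if and only if $M$ is a flat surface in $\mathbb E^4_1$ with flat normal bundle.
   Context: $\mathbb E^4_1$ is $\mathbb R^4$ with the metric $-dx_1^2+dx_2^2+dx_3^2+dx_4^2$. A surface $M$ is space-like if every nonzero tangent vector $v$ satisfies $\langle v,v\rangle>0$. The second fundamental form $h$ and normal connection $D$ are defined by $\widetilde\nabla_XY=\nabla_XY+h(X,Y)$ and $\widetilde\nabla_X\xi=-A_\xi(X)+D_X\xi$, for $X,Y$ tangent and $\xi$ normal. The mean curvature vector is $H=\frac12(h(e_1,e_1)+h(e_2,e_2))$ for an orthonormal tangent frame $\{e_1,e_2\}$. A maximal surface is a space-like surface with $H=0$ identically. $M$ is flat if its Gaussian curvature $K$ vanishes identically; $M$ has flat normal bundle if the curvature tensor $R^D$ of $D$ vanishes identically. The Gauss map is $\nu=e_3\wedge e_4:M\to\bigwedge^2\mathbb E^4_1$, where $\{e_1,e_2,e_3,e_4\}$ is an oriented local orthonormal frame with $e_1,e_2$ tangent and $e_3,e_4$ normal to $M$; $\bigwedge^2\mathbb E^4_1$ is identified with a pseudo-Euclidean space via $\langle f_1\wedge f_2,g_1\wedge g_2\rangle=\det(\langle f_i,g_j\rangle)$. The Laplacian $\Delta=\sum_{i=1}^2(\nabla_{e_i}e_i-e_ie_i)$ of $M$ acts componentwise on $\nu$, and $\nu$ is harmonic if $\Delta\nu=0$. *)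

theory Defs
  imports "HOL-Analysis.Analysis"
begin

section \<open>Smooth maps and directional derivatives\<close>

text \<open>\<open>C\<^sup>k\<close> and \<open>C\<^sup>\<infinity>\<close> maps; only used on open sets \<open>S\<close>.\<close>

primrec Ck_on :: "nat \<Rightarrow> ('a::real_normed_vector \<Rightarrow> 'b::real_normed_vector) \<Rightarrow> 'a set \<Rightarrow> bool" where
  "Ck_on 0 f S \<longleftrightarrow> continuous_on S f"
| "Ck_on (Suc k) f S \<longleftrightarrow>
     (\<forall>p\<in>S. f differentiable (at p)) \<and> (\<forall>v. Ck_on k (\<lambda>p. frechet_derivative f (at p) v) S)"

definition smooth_on :: "('a::real_normed_vector \<Rightarrow> 'b::real_normed_vector) \<Rightarrow> 'a set \<Rightarrow> bool" where
  "smooth_on f S \<longleftrightarrow> (\<forall>k. Ck_on k f S)"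

definition along :: "('a::real_normed_vector \<Rightarrow> 'a) \<Rightarrow> ('a \<Rightarrow> 'b::real_normed_vector) \<Rightarrow> 'a \<Rightarrow> 'b" where
  "along X F = (\<lambda>p. frechet_derivative F (at p) (X p))"

definition lie_bracket ::
  "('a::real_normed_vector \<Rightarrow> 'a) \<Rightarrow> ('a \<Rightarrow> 'a) \<Rightarrow> 'a \<Rightarrow> 'a" where
  "lie_bracket X Y = (\<lambda>p. along X Y p - along Y X p)"


section \<open>Minkowski space and its bivectors\<close>

definition mink :: "real^4 \<Rightarrow> real^4 \<Rightarrow> real" where
  "mink u v = - (u$1 * v$1) + u$2 * v$2 + u$3 * v$3 + u$4 * v$4"

text \<open>A bivector is represented by its skew-symmetric matrix of coordinates with respect to the
  bivectors formed from the standard basis. Up to signs and repetitions, the entries are thus the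
  coordinates in a pseudo-orthonormal basis of the space of bivectors.\<close>

definition wedge :: "real^4 \<Rightarrow> real^4 \<Rightarrow> real^4^4" (infixr "\<and>\<^sub>E" 70) where
  "u \<and>\<^sub>E v = (\<chi> i j. u$i * v$j - u$j * v$i)"


section \<open>Local differential geometry of a parametrized surface\<close>

text \<open>Here \<open>r\<close> is a parametrization, defined on an open set of \<open>\<real>\<^sup>2\<close>. A tangent vector field of the
  surface is given by its components, a map \<open>X :: real^2 \<Rightarrow> real^2\<close>; the corresponding vector field
  in Minkowski space is \<open>push r X\<close>. Functions and normal fields along the surface are given as
  functions of the parameter. Hence \<open>along X F\<close> is the derivative of \<open>F\<close> in the direction of the
  tangent field \<open>X\<close>, and for \<open>F\<close> with values in Minkowski space it is the flat ambient connection.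
  All notions at \<open>p\<close> depend only on the germ of \<open>r\<close> at \<open>p\<close>.\<close>

definition push :: "(real^2 \<Rightarrow> real^4) \<Rightarrow> (real^2 \<Rightarrow> real^2) \<Rightarrow> real^2 \<Rightarrow> real^4" where
  "push r X = (\<lambda>p. frechet_derivative r (at p) (X p))"

definition tangent_plane :: "(real^2 \<Rightarrow> real^4) \<Rightarrow> real^2 \<Rightarrow> (real^4) set" where
  "tangent_plane r p = range (frechet_derivative r (at p))"

definition normal_plane :: "(real^2 \<Rightarrow> real^4) \<Rightarrow> real^2 \<Rightarrow> (real^4) set" where
  "normal_plane r p = {n. \<forall>t\<in>tangent_plane r p. mink n t = 0}"

definition tan_part :: "(real^2 \<Rightarrow> real^4) \<Rightarrow> real^2 \<Rightarrow> real^4 \<Rightarrow> real^4" where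
  "tan_part r p v = (THE t. t \<in> tangent_plane r p \<and> v - t \<in> normal_plane r p)"

definition nor_part :: "(real^2 \<Rightarrow> real^4) \<Rightarrow> real^2 \<Rightarrow> real^4 \<Rightarrow> real^4" where
  "nor_part r p v = v - tan_part r p v"

definition metric :: "(real^2 \<Rightarrow> real^4) \<Rightarrow> (real^2 \<Rightarrow> real^2) \<Rightarrow> (real^2 \<Rightarrow> real^2) \<Rightarrow> real^2 \<Rightarrow> real" where
  "metric r X Y = (\<lambda>p. mink (push r X p) (push r Y p))"

text \<open>Gauss formula: the tangential and the normal part of the ambient derivative of \<open>push r Y\<close>
  are the induced connection (pulled back to components) and the second fundamental form.\<close>

definition nabla :: "(real^2 \<Rightarrow> real^4) \<Rightarrow> (real^2 \<Rightarrow> real^2) \<Rightarrow> (real^2 \<Rightarrow> real^2) \<Rightarrow> real^2 \<Rightarrow> real^2" where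
  "nabla r X Y = (\<lambda>p. inv (frechet_derivative r (at p)) (tan_part r p (along X (push r Y) p)))"

definition second_ff :: "(real^2 \<Rightarrow> real^4) \<Rightarrow> (real^2 \<Rightarrow> real^2) \<Rightarrow> (real^2 \<Rightarrow> real^2) \<Rightarrow> real^2 \<Rightarrow> real^4" where
  "second_ff r X Y = (\<lambda>p. nor_part r p (along X (push r Y) p))"

text \<open>Weingarten formula: the normal connection is the normal part of the ambient derivative of a
  normal field.\<close>

definition normal_conn :: "(real^2 \<Rightarrow> real^4) \<Rightarrow> (real^2 \<Rightarrow> real^2) \<Rightarrow> (real^2 \<Rightarrow> real^4) \<Rightarrow> real^2 \<Rightarrow> real^4" where
  "normal_conn r X \<xi> = (\<lambda>p. nor_part r p (along X \<xi> p))"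

definition orthonormal_frame :: "(real^2 \<Rightarrow> real^4) \<Rightarrow> (real^2) set \<Rightarrow> (2 \<Rightarrow> real^2 \<Rightarrow> real^2) \<Rightarrow> bool" where
  "orthonormal_frame r V e \<longleftrightarrow>
     (\<forall>i. smooth_on (e i) V) \<and>
     (\<forall>q\<in>V. \<forall>i j. metric r (e i) (e j) q = (if i = j then 1 else 0))"

text \<open>The mean curvature vector and the Laplacian at \<open>p\<close>, computed in a local orthonormal frame
  around \<open>p\<close>; the results do not depend on the frame.\<close>

definition mean_curv :: "(real^2 \<Rightarrow> real^4) \<Rightarrow> real^2 \<Rightarrow> real^4" where
  "mean_curv r p = (THE H. \<exists>V e. open V \<and> p \<in> V \<and> orthonormal_frame r V e \<and>
      H = (1/2) *\<^sub>R (\<Sum>i\<in>UNIV. second_ff r (e i) (e i) p))"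

definition laplacian :: "(real^2 \<Rightarrow> real^4) \<Rightarrow> (real^2 \<Rightarrow> 'b::real_normed_vector) \<Rightarrow> real^2 \<Rightarrow> 'b" where
  "laplacian r F p = (THE L. \<exists>V e. open V \<and> p \<in> V \<and> orthonormal_frame r V e \<and>
      L = (\<Sum>i\<in>UNIV. along (nabla r (e i) (e i)) F p - along (e i) (along (e i) F) p))"

definition curvature ::
  "(real^2 \<Rightarrow> real^4) \<Rightarrow> (real^2 \<Rightarrow> real^2) \<Rightarrow> (real^2 \<Rightarrow> real^2) \<Rightarrow> (real^2 \<Rightarrow> real^2) \<Rightarrow> real^2 \<Rightarrow> real^2" where
  "curvature r X Y Z = (\<lambda>p. nabla r X (nabla r Y Z) p - nabla r Y (nabla r X Z) p
      - nabla r (lie_bracket X Y) Z p)"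

text \<open>The Gaussian curvature is the sectional curvature of the tangent plane, here computed from
  the coordinate fields.\<close>

definition gauss_curv :: "(real^2 \<Rightarrow> real^4) \<Rightarrow> real^2 \<Rightarrow> real" where
  "gauss_curv r p =
     (let X = (\<lambda>_. axis 1 1); Y = (\<lambda>_. axis 2 1)
      in metric r (curvature r X Y Y) X p
           / (metric r X X p * metric r Y Y p - (metric r X Y p)\<^sup>2))"

definition normal_curvature ::
  "(real^2 \<Rightarrow> real^4) \<Rightarrow> (real^2 \<Rightarrow> real^2) \<Rightarrow> (real^2 \<Rightarrow> real^2) \<Rightarrow> (real^2 \<Rightarrow> real^4) \<Rightarrow> real^2 \<Rightarrow> real^4" where
  "normal_curvature r X Y \<xi> = (\<lambda>p. normal_conn r X (normal_conn r Y \<xi>) p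
      - normal_conn r Y (normal_conn r X \<xi>) p - normal_conn r (lie_bracket X Y) \<xi> p)"

text \<open>An oriented orthonormal frame of Minkowski space, the first two vectors of which form an
  oriented basis of the tangent plane; then the last two are normal. One of the two normal vectors
  is time-like, but no order is imposed on them.\<close>

definition adapted_frame :: "(real^2 \<Rightarrow> real^4) \<Rightarrow> real^2 \<Rightarrow> (4 \<Rightarrow> real^4) \<Rightarrow> bool" where
  "adapted_frame r p e \<longleftrightarrow>
     (\<forall>i j. i \<noteq> j \<longrightarrow> mink (e i) (e j) = 0) \<and> (\<forall>i. \<bar>mink (e i) (e i)\<bar> = 1) \<and>
     (\<exists>w :: real^2^2. det w > 0 \<and>
        e 1 = frechet_derivative r (at p) (w$1) \<and> e 2 = frechet_derivative r (at p) (w$2)) \<and>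
     e 3 \<in> normal_plane r p \<and> e 4 \<in> normal_plane r p \<and>
     det (\<chi> i. e i) > 0"


section \<open>Immersed surfaces\<close>

text \<open>An abstract surface is given by an atlas, a set of local parametrizations \<open>(U, \<phi>)\<close> of open
  subsets of a Hausdorff second countable space; the surface is the union of the images \<open>\<phi> ` U\<close>.
  A surface in Minkowski space is an abstract surface together with an immersion \<open>x\<close> of it,
  which need not be injective.\<close>

type_synonym 'm atlas = "((real^2) set \<times> (real^2 \<Rightarrow> 'm)) set"

definition oriented_surface :: "'m::{t2_space,second_countable_topology} atlas \<Rightarrow> bool" where
  "oriented_surface A \<longleftrightarrow>
     (\<forall>(U, \<phi>)\<in>A. open U \<and> open (\<phi> ` U) \<and> homeomorphism U (\<phi> ` U) \<phi> (inv_into U \<phi>)) \<and>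
     (\<forall>(U, \<phi>)\<in>A. \<forall>(V, \<psi>)\<in>A.
        let W = U \<inter> \<phi> -` (\<psi> ` V); \<tau> = inv_into V \<psi> \<circ> \<phi>
        in smooth_on \<tau> W \<and> (\<forall>p\<in>W. det (matrix (frechet_derivative \<tau> (at p))) > 0))"

definition immersion :: "'m atlas \<Rightarrow> ('m \<Rightarrow> real^4) \<Rightarrow> bool" where
  "immersion A x \<longleftrightarrow> (\<forall>(U, \<phi>)\<in>A. smooth_on (x \<circ> \<phi>) U \<and>
     (\<forall>p\<in>U. inj (frechet_derivative (x \<circ> \<phi>) (at p))))"

definition space_like :: "'m atlas \<Rightarrow> ('m \<Rightarrow> real^4) \<Rightarrow> bool" where
  "space_like A x \<longleftrightarrow> (\<forall>(U, \<phi>)\<in>A. \<forall>p\<in>U. \<forall>v\<in>tangent_plane (x \<circ> \<phi>) p. v \<noteq> 0 \<longrightarrow> mink v v > 0)"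

definition oriented_maximal_surface ::
  "'m::{t2_space,second_countable_topology} atlas \<Rightarrow> ('m \<Rightarrow> real^4) \<Rightarrow> bool" where
  "oriented_maximal_surface A x \<longleftrightarrow>
     oriented_surface A \<and> immersion A x \<and> space_like A x \<and>
     (\<forall>(U, \<phi>)\<in>A. \<forall>p\<in>U. mean_curv (x \<circ> \<phi>) p = 0)"

definition flat_surface :: "'m atlas \<Rightarrow> ('m \<Rightarrow> real^4) \<Rightarrow> bool" where
  "flat_surface A x \<longleftrightarrow> (\<forall>(U, \<phi>)\<in>A. \<forall>p\<in>U. gauss_curv (x \<circ> \<phi>) p = 0)"

definition flat_normal_bundle :: "'m atlas \<Rightarrow> ('m \<Rightarrow> real^4) \<Rightarrow> bool" where
  "flat_normal_bundle A x \<longleftrightarrow>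
     (\<forall>(U, \<phi>)\<in>A. \<forall>V X Y \<xi>.
        open V \<and> V \<subseteq> U \<and> smooth_on X V \<and> smooth_on Y V \<and>
        smooth_on \<xi> V \<and> (\<forall>q\<in>V. \<xi> q \<in> normal_plane (x \<circ> \<phi>) q) \<longrightarrow>
        (\<forall>p\<in>V. normal_curvature (x \<circ> \<phi>) X Y \<xi> p = 0))"

text \<open>The bivector \<open>e 3 \<and>\<^sub>E e 4\<close> does not depend on the oriented frame.\<close>

definition gauss_map :: "'m atlas \<Rightarrow> ('m \<Rightarrow> real^4) \<Rightarrow> 'm \<Rightarrow> real^4^4" where
  "gauss_map A x m = (THE \<nu>. \<exists>(U, \<phi>)\<in>A. \<exists>p\<in>U. \<exists>e.
      \<phi> p = m \<and> adapted_frame (x \<circ> \<phi>) p e \<and> \<nu> = e 3 \<and>\<^sub>E e 4)"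

definition harmonic :: "'m atlas \<Rightarrow> ('m \<Rightarrow> real^4) \<Rightarrow> ('m \<Rightarrow> 'b::real_normed_vector) \<Rightarrow> bool" where
  "harmonic A x F \<longleftrightarrow> (\<forall>(U, \<phi>)\<in>A. \<forall>p\<in>U. laplacian (x \<circ> \<phi>) (F \<circ> \<phi>) p = 0)"

end

theory Submission
  imports Defs
begin

text \<open>Write \<open>A = h(e\<^sub>1,e\<^sub>1) = - h(e\<^sub>2,e\<^sub>2)\<close> and \<open>C = h(e\<^sub>1,e\<^sub>2)\<close>. Up to the Hodge star, the Gauss map is
  \<open>e\<^sub>1 \<and> e\<^sub>2\<close>, and its Laplacian is the star of \<open>2 (\<langle>A,A\<rangle> + \<langle>C,C\<rangle>) e\<^sub>1 \<and> e\<^sub>2 - 4 A \<and> C\<close>. The two bivectors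
  are orthogonal, hence the Laplacian vanishes iff \<open>\<langle>A,A\<rangle> + \<langle>C,C\<rangle> = 0\<close> and \<open>A \<and> C = 0\<close>. By the Gauss
  equation \<open>\<langle>A,A\<rangle> + \<langle>C,C\<rangle> = - K\<close>, and by the Ricci equation \<open>R\<^sup>D(e\<^sub>1,e\<^sub>2) \<xi> = 2 (\<langle>C,\<xi>\<rangle> A - \<langle>A,\<xi>\<rangle> C)\<close>, which
  vanishes for all normal \<open>\<xi>\<close> iff \<open>A \<and> C = 0\<close>. The Laplacian is computed at a point \<open>p\<close> with derivatives in the
  constant directions \<open>u = e\<^sub>1(p)\<close> and \<open>v = e\<^sub>2(p)\<close>, so that no brackets of frame fields occur.\<close>

section \<open>Smooth maps\<close>

text \<open>Differentiating \<open>e 3\<close> and \<open>e 4\<close> directly would require smooth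
  normal frame fields; passing to the dual of the tangent bivector removes them. Near
  \<open>p\<close> this dual is a scalar function times \<open>dual (D u r q) (D v r q)\<close>, so
  only partial derivatives of \<open>r\<close> and of that scalar occur. The obstacle is that third
  derivatives of \<open>r\<close> appear. Maximality is therefore used at all points near
  \<open>p\<close> and differentiated. The scalar is never differentiated through the frame fields:
  the constant length of the Gauss map supplies its first derivatives and, at the end, the whole
  coefficient of the Gauss map in the Laplacian. The normal planes are Lorentzian, so the vanishing
  of \<open>\<langle>A,A\<rangle> + \<langle>C,C\<rangle>\<close> does not force A = C = 0, which is
  why the normal bundle enters as a separate condition. Since \<open>mean_curv\<close> and
  \<open>laplacian\<close> are definite descriptions, each evaluation also needs independence of the
  frame, obtained from traces of symmetric bilinear forms.\<close>

abbreviation D :: "'a::real_normed_vector \<Rightarrow> ('a \<Rightarrow> 'b::real_normed_vector) \<Rightarrow> 'a \<Rightarrow> 'b" where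
  "D v F \<equiv> along (\<lambda>_. v) F"

lemma along_eq_D: "along X F p = D (X p) F p"
  by (simp add: along_def)

lemma along_eqI: "(F has_derivative F') (at p) \<Longrightarrow> along X F p = F' (X p)"
  by (metis along_def frechet_derivative_at)

lemma has_derivative_D: "F differentiable (at p) \<Longrightarrow> (F has_derivative (\<lambda>v. D v F p)) (at p)"
  by (simp add: along_def frechet_derivative_works)

lemma linear_D: "F differentiable (at p) \<Longrightarrow> linear (\<lambda>v. D v F p)"
  by (simp add: along_def linear_frechet_derivative)

lemma along_cong_open:
  assumes "open S" "p \<in> S" "\<And>q. q \<in> S \<Longrightarrow> F q = G q"
  shows "along X F p = along X G p"
  unfolding along_def
proof (cases "F differentiable at p")
  case True
  then show "frechet_derivative F (at p) (X p) = frechet_derivative G (at p) (X p)"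
    using frechet_derivative_transform_within_open[OF _ assms(1,2), of F G] assms(3) by simp
next
  case False
  \<comment> \<open>Without a derivative, \<open>frechet_derivative\<close> is a choice from the
    predicate \<open>has_derivative\<close>; the predicates for \<open>F\<close> and
    \<open>G\<close> coincide, hence so do the chosen values.\<close>
  have "(F has_derivative F') (at p) \<longleftrightarrow> (G has_derivative F') (at p)" for F'
    using has_derivative_transform_within_open[OF _ assms(1,2)] assms(3) by metis
  then show "frechet_derivative F (at p) (X p) = frechet_derivative G (at p) (X p)"
    by (simp add: frechet_derivative_def)
qed

lemma Ck_on_Suc_iff: "Ck_on (Suc k) f S \<longleftrightarrow> (\<forall>p\<in>S. f differentiable (at p)) \<and> (\<forall>v. Ck_on k (D v f) S)"
  by (simp add: along_def)

declare Ck_on.simps(2) [simp del]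

lemma Ck_on_cong:
  assumes "open S" "\<And>q. q \<in> S \<Longrightarrow> f q = g q"
  shows "Ck_on k f S \<longleftrightarrow> Ck_on k g S"
  using assms(2)
proof (induction k arbitrary: f g)
  case 0
  then show ?case by (simp cong: continuous_on_cong)
next
  case (Suc k)
  have "f differentiable at p \<longleftrightarrow> g differentiable at p" if "p \<in> S" for p
    using has_derivative_transform_within_open[OF _ assms(1) that] Suc.prems
    unfolding differentiable_def by metis
  moreover have "Ck_on k (D v f) S \<longleftrightarrow> Ck_on k (D v g) S" for v
    by (rule Suc.IH) (use along_cong_open[OF assms(1)] Suc.prems in blast)
  ultimately show ?case by (auto simp: Ck_on_Suc_iff)
qed

lemma Ck_on_Suc_lower: "Ck_on (Suc k) f S \<Longrightarrow> Ck_on k f S"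
proof (induction k arbitrary: f)
  case 0
  then show ?case
    unfolding Ck_on_Suc_iff Ck_on.simps(1)
    by (meson differentiable_imp_continuous_within continuous_at_imp_continuous_on)
next
  case (Suc k)
  then show ?case
    using Ck_on_Suc_iff[of "Suc k" f S] Ck_on_Suc_iff[of k f S] by blast
qed

lemma Ck_on_subset: "Ck_on k f S \<Longrightarrow> T \<subseteq> S \<Longrightarrow> Ck_on k f T"
proof (induction k arbitrary: f)
  case 0
  then show ?case by (auto intro: continuous_on_subset)
next
  case (Suc k)
  then show ?case by (auto simp: Ck_on_Suc_iff)
qed

lemma Ck_on_const: "Ck_on k (\<lambda>_. c) S"
proof (induction k arbitrary: c)
  case (Suc k)
  then show ?case by (simp add: Ck_on_Suc_iff along_def)
qed simp

text \<open>Stated for bounded bilinear maps in general, so that \<open>mink\<close>,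
  \<open>dual\<close>, \<open>bivec_form\<close> and scalar multiplication are all covered.\<close>

lemma (in bounded_bilinear) along_prod:
  assumes "f differentiable (at p)" "g differentiable (at p)"
  shows "along X (\<lambda>q. prod (f q) (g q)) p = prod (f p) (along X g p) + prod (along X f p) (g p)"
  using along_eqI[OF FDERIV[OF has_derivative_D[OF assms(1)] has_derivative_D[OF assms(2)]], of X]
  by (simp only: along_eq_D[of X f] along_eq_D[of X g])

lemma (in bounded_linear) along_image:
  assumes "g differentiable (at p)"
  shows "along X (\<lambda>q. f (g q)) p = f (along X g p)"
  using along_eqI[OF has_derivative[OF has_derivative_D[OF assms]], of X]
  by (simp only: along_eq_D[of X g])

lemma along_add:
  assumes "f differentiable (at p)" "g differentiable (at p)"
  shows "along X (\<lambda>q. f q + g q) p = along X f p + along X g p"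
  using along_eqI[OF has_derivative_add[OF has_derivative_D[OF assms(1)] has_derivative_D[OF assms(2)]], of X]
  by (simp only: along_eq_D[of X f] along_eq_D[of X g])

lemma along_diff:
  assumes "f differentiable (at p)" "g differentiable (at p)"
  shows "along X (\<lambda>q. f q - g q) p = along X f p - along X g p"
  using along_eqI[OF has_derivative_diff[OF has_derivative_D[OF assms(1)] has_derivative_D[OF assms(2)]], of X]
  by (simp only: along_eq_D[of X f] along_eq_D[of X g])

lemma along_const [simp]: "along X (\<lambda>_. c) p = 0"
  by (simp add: along_def)

section \<open>Closure of C^k and smooth maps under algebraic operations\<close>

lemma Ck_on_add:
  assumes "open S"
  shows "Ck_on k f S \<Longrightarrow> Ck_on k g S \<Longrightarrow> Ck_on k (\<lambda>q. f q + g q) S"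
proof (induction k arbitrary: f g)
  case 0
  then show ?case by (simp add: continuous_on_add)
next
  case (Suc k)
  have "Ck_on k (D v (\<lambda>q. f q + g q)) S \<longleftrightarrow> Ck_on k (\<lambda>q. D v f q + D v g q) S" for v
    by (rule Ck_on_cong[OF assms]) (use Suc.prems in \<open>simp add: Ck_on_Suc_iff along_add\<close>)
  then show ?case using Suc by (auto simp: Ck_on_Suc_iff)
qed

lemma (in bounded_bilinear) Ck_on:
  assumes "open S"
  shows "Ck_on k f S \<Longrightarrow> Ck_on k g S \<Longrightarrow> Ck_on k (\<lambda>q. prod (f q) (g q)) S"
proof (induction k arbitrary: f g)
  case 0
  then show ?case by (simp add: continuous_on)
next
  case (Suc k)
  have "Ck_on k (D v (\<lambda>q. prod (f q) (g q))) S \<longleftrightarrow> Ck_on k (\<lambda>q. prod (f q) (D v g q) + prod (D v f q) (g q)) S" for v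
    by (rule Ck_on_cong[OF assms]) (use Suc.prems in \<open>simp add: Ck_on_Suc_iff along_prod\<close>)
  moreover have "Ck_on k (\<lambda>q. prod (f q) (D v g q) + prod (D v f q) (g q)) S" for v
    by (intro Ck_on_add[OF assms] Suc.IH Suc.prems[THEN Ck_on_Suc_lower])
      (use Suc.prems in \<open>simp_all add: Ck_on_Suc_iff\<close>)
  moreover have "(\<lambda>q. prod (f q) (g q)) differentiable at p" if "p \<in> S" for p
    using Suc.prems that FDERIV unfolding Ck_on_Suc_iff differentiable_def by blast
  ultimately show ?case by (auto simp: Ck_on_Suc_iff)
qed

text \<open>The derivative of 1/f is a product of 1/f, the derivative of f and 1/f again, so the
  induction hypothesis for the inverse itself yields the next order.\<close>

lemma Ck_on_inverse:
  fixes f :: "'a::real_normed_vector \<Rightarrow> real"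
  assumes "open S" "\<And>q. q \<in> S \<Longrightarrow> f q \<noteq> 0"
  shows "Ck_on k f S \<Longrightarrow> Ck_on k (\<lambda>q. inverse (f q)) S"
proof (induction k)
  case 0
  then show ?case using assms by (simp add: continuous_on_inverse)
next
  case (Suc k)
  have diff: "f differentiable at p" if "p \<in> S" for p
    using Suc.prems that by (simp add: Ck_on_Suc_iff)
  have der: "((\<lambda>q. inverse (f q)) has_derivative (\<lambda>h. - (inverse (f p) * D h f p * inverse (f p)))) (at p)" if "p \<in> S" for p
    using Deriv.has_derivative_inverse[OF assms(2)[OF that] has_derivative_D[OF diff[OF that]]] .
  have "Ck_on k (D v (\<lambda>q. inverse (f q))) S \<longleftrightarrow> Ck_on k (\<lambda>q. (-1) * (inverse (f q) * D v f q * inverse (f q))) S" for v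
    by (rule Ck_on_cong[OF assms(1)]) (use along_eqI[OF der] in auto)
  moreover have "Ck_on k (\<lambda>q. (-1) * (inverse (f q) * D v f q * inverse (f q))) S" for v
    by (intro bounded_bilinear.Ck_on[OF bounded_bilinear_mult assms(1)] Ck_on_const
        Suc.IH Suc.prems[THEN Ck_on_Suc_lower])
      (use Suc.prems in \<open>simp add: Ck_on_Suc_iff\<close>)
  ultimately show ?case using der by (auto simp: Ck_on_Suc_iff differentiable_def)
qed

text \<open>As for the inverse: the derivative contains the square root itself, to which the
  induction hypothesis and then \<open>Ck_on_inverse\<close> apply.\<close>

lemma Ck_on_sqrt:
  fixes f :: "'a::real_normed_vector \<Rightarrow> real"
  assumes "open S" "\<And>q. q \<in> S \<Longrightarrow> f q > 0"
  shows "Ck_on k f S \<Longrightarrow> Ck_on k (\<lambda>q. sqrt (f q)) S"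
proof (induction k)
  case 0
  then show ?case by (simp add: continuous_on_real_sqrt)
next
  case (Suc k)
  have diff: "f differentiable at p" if "p \<in> S" for p
    using Suc.prems that by (simp add: Ck_on_Suc_iff)
  have der: "((\<lambda>q. sqrt (f q)) has_derivative (\<lambda>h. D h f p * (inverse (sqrt (f p)) / 2))) (at p)" if "p \<in> S" for p
    using has_derivative_real_sqrt[OF assms(2)[OF that] has_derivative_D[OF diff[OF that]]]
    by (simp add: mult.commute field_simps)
  have "Ck_on k (D v (\<lambda>q. sqrt (f q))) S \<longleftrightarrow> Ck_on k (\<lambda>q. D v f q * (inverse (sqrt (f q)) * (1/2))) S" for v
    by (rule Ck_on_cong[OF assms(1)]) (use along_eqI[OF der] in auto)
  moreover have "Ck_on k (\<lambda>q. D v f q * (inverse (sqrt (f q)) * (1/2))) S" for v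
  proof (intro bounded_bilinear.Ck_on[OF bounded_bilinear_mult assms(1)] Ck_on_const Ck_on_inverse assms(1))
    show "Ck_on k (D v f) S" using Suc.prems by (simp add: Ck_on_Suc_iff)
    show "sqrt (f q) \<noteq> 0" if "q \<in> S" for q using assms(2)[OF that] by simp
    show "Ck_on k (\<lambda>q. sqrt (f q)) S" using Suc.IH Ck_on_Suc_lower[OF Suc.prems] .
  qed
  ultimately show ?case using der by (auto simp: Ck_on_Suc_iff differentiable_def)
qed

lemma smooth_on_cong: "open S \<Longrightarrow> (\<And>q. q \<in> S \<Longrightarrow> f q = g q) \<Longrightarrow> smooth_on f S \<longleftrightarrow> smooth_on g S"
  using Ck_on_cong unfolding smooth_on_def by blast

lemma smooth_on_subset: "smooth_on f S \<Longrightarrow> T \<subseteq> S \<Longrightarrow> smooth_on f T"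
  using Ck_on_subset unfolding smooth_on_def by blast

lemma smooth_on_differentiable: "smooth_on f S \<Longrightarrow> p \<in> S \<Longrightarrow> f differentiable (at p)"
  using Ck_on_Suc_iff unfolding smooth_on_def by blast

lemma smooth_on_continuous: "smooth_on f S \<Longrightarrow> continuous_on S f"
  using Ck_on.simps(1) unfolding smooth_on_def by blast

lemma smooth_on_D: "smooth_on f S \<Longrightarrow> smooth_on (D v f) S"
  using Ck_on_Suc_iff unfolding smooth_on_def by blast

lemma smooth_on_const: "smooth_on (\<lambda>_. c) S"
  by (simp add: smooth_on_def Ck_on_const)

lemma smooth_on_add: "open S \<Longrightarrow> smooth_on f S \<Longrightarrow> smooth_on g S \<Longrightarrow> smooth_on (\<lambda>q. f q + g q) S"
  by (simp add: smooth_on_def Ck_on_add)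

lemma (in bounded_bilinear) smooth_on:
  "open S \<Longrightarrow> smooth_on f S \<Longrightarrow> smooth_on g S \<Longrightarrow> smooth_on (\<lambda>q. prod (f q) (g q)) S"
  by (simp add: smooth_on_def Ck_on)

lemmas smooth_on_mult = bounded_bilinear.smooth_on[OF bounded_bilinear_mult]
lemmas smooth_on_scaleR = bounded_bilinear.smooth_on[OF bounded_bilinear_scaleR]

lemma smooth_on_diff:
  assumes "open S" "smooth_on f S" "smooth_on g S"
  shows "smooth_on (\<lambda>q. f q - g q) S"
  using smooth_on_add[OF assms(1,2) smooth_on_scaleR[OF assms(1) smooth_on_const[of "-1"] assms(3)]] by simp

lemma smooth_on_inverse:
  fixes f :: "'a::real_normed_vector \<Rightarrow> real"
  shows "open S \<Longrightarrow> (\<And>q. q \<in> S \<Longrightarrow> f q \<noteq> 0) \<Longrightarrow> smooth_on f S \<Longrightarrow> smooth_on (\<lambda>q. inverse (f q)) S"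
  by (simp add: smooth_on_def Ck_on_inverse)

lemma smooth_on_sqrt:
  fixes f :: "'a::real_normed_vector \<Rightarrow> real"
  shows "open S \<Longrightarrow> (\<And>q. q \<in> S \<Longrightarrow> f q > 0) \<Longrightarrow> smooth_on f S \<Longrightarrow> smooth_on (\<lambda>q. sqrt (f q)) S"
  by (simp add: smooth_on_def Ck_on_sqrt)

lemma (in bounded_linear) smooth_on:
  assumes "open S" "smooth_on g S"
  shows "smooth_on (\<lambda>q. f (g q)) S"
proof -
  have "Ck_on k (\<lambda>q. f (g q)) S" if "Ck_on k g S" for k g
    using that
  proof (induction k arbitrary: g)
    case 0
    then show ?case by (simp add: continuous_on)
  next
    case (Suc k)
    have "Ck_on k (D v (\<lambda>q. f (g q))) S \<longleftrightarrow> Ck_on k (\<lambda>q. f (D v g q)) S" for v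
      by (rule Ck_on_cong[OF assms(1)]) (use Suc.prems in \<open>simp add: Ck_on_Suc_iff along_image\<close>)
    moreover have "(\<lambda>q. f (g q)) differentiable at p" if "p \<in> S" for p
      using Suc.prems that has_derivative unfolding Ck_on_Suc_iff differentiable_def by blast
    ultimately show ?case using Suc by (auto simp: Ck_on_Suc_iff)
  qed
  then show ?thesis using assms(2) by (simp add: smooth_on_def)
qed

lemma smooth_on_sum:
  assumes "open S" "\<And>i. i \<in> I \<Longrightarrow> smooth_on (f i) S"
  shows "smooth_on (\<lambda>q. \<Sum>i\<in>I. f i q) S"
  using assms(2) by (induction I rule: infinite_finite_induct) (auto intro: smooth_on_const smooth_on_add[OF assms(1)])

lemma along_eq_sum_Basis:
  fixes F :: "'a::euclidean_space \<Rightarrow> 'b::real_normed_vector"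
  assumes "F differentiable (at p)"
  shows "along X F p = (\<Sum>b\<in>Basis. (X p \<bullet> b) *\<^sub>R D b F p)"
proof -
  interpret linear "\<lambda>v. D v F p" using assms by (rule linear_D)
  have "along X F p = D (\<Sum>b\<in>Basis. (X p \<bullet> b) *\<^sub>R b) F p"
    by (subst along_eq_D) (simp add: euclidean_representation)
  then show ?thesis by (simp add: sum scaleR)
qed

text \<open>The direction varies with the point, so the derivative is expanded in the constant basis
  directions, where \<open>smooth_on_D\<close> applies.\<close>

lemma smooth_on_along:
  fixes F :: "'a::euclidean_space \<Rightarrow> 'b::real_normed_vector"
  assumes "open S" "smooth_on F S" "smooth_on X S"
  shows "smooth_on (along X F) S"
proof -
  have "smooth_on (\<lambda>p. \<Sum>b\<in>Basis. (X p \<bullet> b) *\<^sub>R D b F p) S"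
    using assms by (intro smooth_on_sum smooth_on_scaleR smooth_on_D
        bounded_linear.smooth_on[OF bounded_linear_inner_left])
  moreover have "along X F p = (\<Sum>b\<in>Basis. (X p \<bullet> b) *\<^sub>R D b F p)" if "p \<in> S" for p
    using along_eq_sum_Basis smooth_on_differentiable[OF assms(2) that] by blast
  ultimately show ?thesis
    using smooth_on_cong[OF assms(1), of "along X F" "\<lambda>p. \<Sum>b\<in>Basis. (X p \<bullet> b) *\<^sub>R D b F p"] by blast
qed

text \<open>Separates the derivative of the field \<open>Y\<close> from a second derivative in two
  constant directions. The tensoriality of the second fundamental form and of the Hessian rests on
  this.\<close>

lemma along_along:
  fixes F :: "'a::euclidean_space \<Rightarrow> 'b::real_normed_vector"
  assumes "open S" "smooth_on F S" "p \<in> S" "Y differentiable (at p)"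
  shows "along X (along Y F) p = D (along X Y p) F p + D (X p) (D (Y p) F) p"
proof -
  have dF: "F differentiable (at q)" if "q \<in> S" for q
    using smooth_on_differentiable assms(2) that by blast
  have d2: "D b F differentiable (at p)" for b
    using smooth_on_differentiable smooth_on_D assms by blast
  have dY: "(\<lambda>q. Y q \<bullet> b) differentiable (at p)" for b
    using assms(4) bounded_linear.has_derivative[OF bounded_linear_inner_left]
    unfolding differentiable_def by blast
  have eq: "along X (along Z F) p = along X (\<lambda>q. \<Sum>b\<in>Basis. (Z q \<bullet> b) *\<^sub>R D b F q) p" for Z
    by (rule along_cong_open[OF assms(1,3)]) (simp add: along_eq_sum_Basis dF)
  have sum: "along X (\<lambda>q. \<Sum>b\<in>Basis. (Z q \<bullet> b) *\<^sub>R D b F q) p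
     = (\<Sum>b\<in>Basis. (Z p \<bullet> b) *\<^sub>R along X (D b F) p + (along X Z p \<bullet> b) *\<^sub>R D b F p)"
    if Z: "Z differentiable (at p)" for Z
  proof -
    have dZ: "((\<lambda>q. Z q \<bullet> b) has_derivative (\<lambda>h. D h Z p \<bullet> b)) (at p)" for b
      using bounded_linear.has_derivative[OF bounded_linear_inner_left has_derivative_D[OF Z]] .
    have "((\<lambda>q. \<Sum>b\<in>Basis. (Z q \<bullet> b) *\<^sub>R D b F q) has_derivative
       (\<lambda>h. \<Sum>b\<in>Basis. (Z p \<bullet> b) *\<^sub>R D h (D b F) p + (D h Z p \<bullet> b) *\<^sub>R D b F p)) (at p)"
      by (intro has_derivative_sum has_derivative_scaleR dZ has_derivative_D d2)
    from along_eqI[OF this, of X] show ?thesis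
      by (simp only: along_eq_D[of X Z] along_eq_D[of X "D _ F"])
  qed
  \<comment> \<open>The same expansion for the constant field with value \<open>Y p\<close>
    identifies the second-order terms.\<close>
  have "D (X p) (D (Y p) F) p = (\<Sum>b\<in>Basis. (Y p \<bullet> b) *\<^sub>R along X (D b F) p)"
    using eq[of "\<lambda>_. Y p"] sum[of "\<lambda>_. Y p"] by (simp add: along_eq_D[of X "D (Y p) F"])
  moreover have "D (along X Y p) F p = (\<Sum>b\<in>Basis. (along X Y p \<bullet> b) *\<^sub>R D b F p)"
    by (rule along_eq_sum_Basis[OF dF[OF assms(3)]])
  ultimately show ?thesis
    using eq[of Y] sum[OF assms(4)] by (simp add: sum.distrib add.commute)
qed

section \<open>Symmetry of mixed second derivatives\<close>

lemma line_has_real_derivative: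
  fixes f :: "'a::real_normed_vector \<Rightarrow> real"
  assumes "f differentiable (at (x + s *\<^sub>R u))"
  shows "((\<lambda>s. f (x + s *\<^sub>R u)) has_real_derivative D u f (x + s *\<^sub>R u)) (at s)"
proof -
  interpret linear "\<lambda>v. D v f (x + s *\<^sub>R u)" using assms by (rule linear_D)
  have "((\<lambda>s. x + s *\<^sub>R u) has_derivative (\<lambda>h. h *\<^sub>R u)) (at s)"
    by (auto intro!: derivative_eq_intros)
  from diff_chain_at[OF this has_derivative_D[OF assms]]
  have "((\<lambda>s. f (x + s *\<^sub>R u)) has_derivative (\<lambda>h. D (h *\<^sub>R u) f (x + s *\<^sub>R u))) (at s)"
    by (simp add: o_def)
  then show ?thesis
    by (simp add: has_field_derivative_def scale mult.commute[of _ "D u f _"])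
qed

text \<open>Two applications of the mean value theorem: in \<open>s\<close> to the increment of
  \<open>f\<close> along \<open>h *\<^sub>R v\<close>, then in \<open>t\<close> to
  \<open>D u f\<close>.\<close>

lemma second_difference_mean_value:
  fixes f :: "'a::real_normed_vector \<Rightarrow> real"
  assumes "h > 0"
    and f: "\<And>s t. s \<in> {0..h} \<Longrightarrow> t \<in> {0..h} \<Longrightarrow> f differentiable (at (p + s *\<^sub>R u + t *\<^sub>R v))"
    and Df: "\<And>s t. s \<in> {0..h} \<Longrightarrow> t \<in> {0..h} \<Longrightarrow> D u f differentiable (at (p + s *\<^sub>R u + t *\<^sub>R v))"
  obtains s t where "s \<in> {0..h}" "t \<in> {0..h}"
    "f (p + h *\<^sub>R u + h *\<^sub>R v) - f (p + h *\<^sub>R u) - f (p + h *\<^sub>R v) + f p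
       = h * h * D v (D u f) (p + s *\<^sub>R u + t *\<^sub>R v)"
proof -
  have shift: "((\<lambda>s. f (p + s *\<^sub>R u + t *\<^sub>R v)) has_real_derivative D u f (p + s *\<^sub>R u + t *\<^sub>R v)) (at s)"
    if "s \<in> {0..h}" "t \<in> {0..h}" for s t
    using line_has_real_derivative[of f "p + t *\<^sub>R v" s u] f[OF that] by (simp add: algebra_simps)
  have "((\<lambda>s. f (p + s *\<^sub>R u + h *\<^sub>R v) - f (p + s *\<^sub>R u)) has_real_derivative
      D u f (p + s *\<^sub>R u + h *\<^sub>R v) - D u f (p + s *\<^sub>R u)) (at s)" if "0 \<le> s" "s \<le> h" for s
    using DERIV_diff[OF shift[of s h] shift[of s 0]] that by simp
  from MVT2[OF \<open>h > 0\<close> this] obtain s where s: "0 < s" "s < h"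
    "f (p + h *\<^sub>R u + h *\<^sub>R v) - f (p + h *\<^sub>R u) - (f (p + h *\<^sub>R v) - f p)
       = h * (D u f (p + s *\<^sub>R u + h *\<^sub>R v) - D u f (p + s *\<^sub>R u))"
    by auto
  have "((\<lambda>t. D u f (p + s *\<^sub>R u + t *\<^sub>R v)) has_real_derivative
      D v (D u f) (p + s *\<^sub>R u + t *\<^sub>R v)) (at t)" if "0 \<le> t" "t \<le> h" for t
    using line_has_real_derivative[OF Df[of s t]] s that by simp
  from MVT2[OF \<open>h > 0\<close> this] obtain t where "0 < t" "t < h"
    "D u f (p + s *\<^sub>R u + h *\<^sub>R v) - D u f (p + s *\<^sub>R u) = h * D v (D u f) (p + s *\<^sub>R u + t *\<^sub>R v)"
    by auto
  with s show ?thesis by (intro that[of s t]) auto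
qed

text \<open>The second difference over a parallelogram is symmetric in \<open>u\<close> and
  \<open>v\<close>. Divided by \<open>h * h\<close> it is a value of each mixed derivative near
  \<open>p\<close>, and both are continuous.\<close>

lemma D_commute_real:
  fixes f :: "'a::real_normed_vector \<Rightarrow> real"
  assumes "open S" "smooth_on f S" "p \<in> S"
  shows "D u (D v f) p = D v (D u f) p"
proof -
  have "\<bar>D u (D v f) p - D v (D u f) p\<bar> \<le> \<epsilon>" if "\<epsilon> > 0" for \<epsilon>
  proof -
    have "isCont (D u (D v f)) p" "isCont (D v (D u f)) p"
      using assms smooth_on_D smooth_on_continuous continuous_on_eq_continuous_at by blast+
    then have "(D u (D v f) \<longlongrightarrow> D u (D v f) p) (nhds p)" "(D v (D u f) \<longlongrightarrow> D v (D u f) p) (nhds p)"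
      by (simp_all add: isCont_def tendsto_at_iff_tendsto_nhds)
    from tendstoD[OF this(1), of "\<epsilon>/2"] tendstoD[OF this(2), of "\<epsilon>/2"] have "\<forall>\<^sub>F q in nhds p. q \<in> S \<and> dist (D u (D v f) q) (D u (D v f) p) < \<epsilon>/2
        \<and> dist (D v (D u f) q) (D v (D u f) p) < \<epsilon>/2"
      using assms(1,3) that
      by (intro eventually_conj eventually_nhds_in_open) auto
    then obtain d where d: "d > 0" and near: "\<And>q. dist q p < d \<Longrightarrow> q \<in> S \<and> \<bar>D u (D v f) q - D u (D v f) p\<bar> < \<epsilon>/2
        \<and> \<bar>D v (D u f) q - D v (D u f) p\<bar> < \<epsilon>/2"
      unfolding eventually_nhds_metric dist_real_def by blast
    \<comment> \<open>Keeps the parallelogram inside the ball of radius \<open>d\<close>; the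
      summand 1 makes the denominator positive even if both vectors vanish.\<close>
    define h where "h = d / (norm u + norm v + 1)"
    have h: "h > 0" "h * (norm u + norm v) < d"
      using d by (auto simp: h_def field_simps add_pos_nonneg add_nonneg_pos)
    have dist: "dist (p + s *\<^sub>R a + t *\<^sub>R b) p < d"
      if "s \<in> {0..h}" "t \<in> {0..h}" "{a, b} = {u, v}" for s t a b
    proof -
      have "norm (s *\<^sub>R a + t *\<^sub>R b) \<le> s * norm a + t * norm b"
        using that by (intro order_trans[OF norm_triangle_ineq]) simp
      also have "\<dots> \<le> h * norm a + h * norm b"
        using that by (intro add_mono mult_right_mono) auto
      also have "norm a + norm b = norm u + norm v"
        using that(3) by (auto simp: doubleton_eq_iff)
      then have "h * norm a + h * norm b < d" using h by (metis distrib_left)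
      finally show ?thesis by (simp add: dist_norm add.assoc)
    qed
    have diff: "f differentiable (at q)" "D w f differentiable (at q)" if "dist q p < d" for q w
      using near[OF that] assms smooth_on_D smooth_on_differentiable by blast+
    obtain s t where st: "s \<in> {0..h}" "t \<in> {0..h}"
      "f (p + h *\<^sub>R u + h *\<^sub>R v) - f (p + h *\<^sub>R u) - f (p + h *\<^sub>R v) + f p
       = h * h * D v (D u f) (p + s *\<^sub>R u + t *\<^sub>R v)"
      by (rule second_difference_mean_value[of h f p u v]) (use h(1) diff dist[of _ _ u v] in auto)
    obtain s' t' where st': "s' \<in> {0..h}" "t' \<in> {0..h}"
      "f (p + h *\<^sub>R v + h *\<^sub>R u) - f (p + h *\<^sub>R v) - f (p + h *\<^sub>R u) + f p
       = h * h * D u (D v f) (p + s' *\<^sub>R v + t' *\<^sub>R u)"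
      by (rule second_difference_mean_value[of h f p v u]) (use h(1) diff dist[of _ _ v u] in \<open>auto simp: insert_commute\<close>)
    have "h * h * D v (D u f) (p + s *\<^sub>R u + t *\<^sub>R v) = h * h * D u (D v f) (p + s' *\<^sub>R v + t' *\<^sub>R u)"
      unfolding st(3)[symmetric] st'(3)[symmetric] by (simp add: algebra_simps)
    then have "D v (D u f) (p + s *\<^sub>R u + t *\<^sub>R v) = D u (D v f) (p + s' *\<^sub>R v + t' *\<^sub>R u)"
      using h(1) by simp
    moreover have "\<bar>D v (D u f) (p + s *\<^sub>R u + t *\<^sub>R v) - D v (D u f) p\<bar> < \<epsilon>/2"
      using near dist st(1,2) by blast
    moreover have "\<bar>D u (D v f) (p + s' *\<^sub>R v + t' *\<^sub>R u) - D u (D v f) p\<bar> < \<epsilon>/2"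
      using near dist[OF st'(1,2)] by (simp add: insert_commute)
    ultimately show ?thesis by linarith
  qed
  from field_le_epsilon[of "\<bar>D u (D v f) p - D v (D u f) p\<bar>" 0] this show ?thesis by simp
qed

lemma D_commute:
  fixes f :: "'a::real_normed_vector \<Rightarrow> 'b::real_inner"
  assumes "open S" "smooth_on f S" "p \<in> S"
  shows "D u (D v f) p = D v (D u f) p"
proof -
  have "D u (D v f) p \<bullet> w = D v (D u f) p \<bullet> w" for w
  proof -
    interpret bounded_linear "\<lambda>x::'b. x \<bullet> w" by (rule bounded_linear_inner_left)
    have "D a (D b (\<lambda>q. f q \<bullet> w)) p = D a (D b f) p \<bullet> w" for a b
    proof -
      have "D a (D b (\<lambda>q. f q \<bullet> w)) p = D a (\<lambda>q. D b f q \<bullet> w) p"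
        by (rule along_cong_open[OF assms(1,3)]) (use along_image smooth_on_differentiable[OF assms(2)] in blast)
      then show ?thesis
        using along_image smooth_on_differentiable[OF smooth_on_D[OF assms(2)] assms(3)] by metis
    qed
    with D_commute_real[OF assms(1) smooth_on[OF assms(1,2)] assms(3)] show ?thesis by metis
  qed
  then show ?thesis by (metis vector_eq_rdot)
qed

section \<open>Minkowski space and the dual of a bivector\<close>

lemma det_4:
  "det (M::'a::comm_ring_1^4^4) =
    M$1$1 * (M$2$2 * (M$3$3 * M$4$4 - M$3$4 * M$4$3) - M$2$3 * (M$3$2 * M$4$4 - M$3$4 * M$4$2)
      + M$2$4 * (M$3$2 * M$4$3 - M$3$3 * M$4$2))
  - M$1$2 * (M$2$1 * (M$3$3 * M$4$4 - M$3$4 * M$4$3) - M$2$3 * (M$3$1 * M$4$4 - M$3$4 * M$4$1)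
      + M$2$4 * (M$3$1 * M$4$3 - M$3$3 * M$4$1))
  + M$1$3 * (M$2$1 * (M$3$2 * M$4$4 - M$3$4 * M$4$2) - M$2$2 * (M$3$1 * M$4$4 - M$3$4 * M$4$1)
      + M$2$4 * (M$3$1 * M$4$2 - M$3$2 * M$4$1))
  - M$1$4 * (M$2$1 * (M$3$2 * M$4$3 - M$3$3 * M$4$2) - M$2$2 * (M$3$1 * M$4$3 - M$3$3 * M$4$1)
      + M$2$3 * (M$3$1 * M$4$2 - M$3$2 * M$4$1))"
proof -
  have f1: "finite {2::4, 3, 4}" "1 \<notin> {2::4, 3, 4}" by auto
  have f2: "finite {3::4, 4}" "2 \<notin> {3::4, 4}" by auto
  have f3: "finite {4::4}" "3 \<notin> {4::4}" by auto
  show ?thesis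
    unfolding det_def UNIV_4
    unfolding sum_over_permutations_insert[OF f1]
    unfolding sum_over_permutations_insert[OF f2]
    unfolding sum_over_permutations_insert[OF f3]
    unfolding permutes_sing
    by (simp add: sign_swap_id permutation_swap_id permutation_compose sign_compose sign_id swap_id_eq algebra_simps)
qed

lemma mink_commute: "mink u v = mink v u"
  by (simp add: mink_def mult.commute)

interpretation mink: bounded_bilinear mink
proof -
  have "bilinear mink"
    unfolding bilinear_def by (auto intro!: linearI simp: mink_def algebra_simps)
  then show "bounded_bilinear mink" by (simp add: bilinear_conv_bounded_bilinear)
qed

lemmas mink_linear = mink.add_left mink.add_right mink.diff_left mink.diff_right
  mink.scaleR_left mink.scaleR_right mink.minus_left mink.minus_right mink.zero_left mink.zero_right

lemma axis_nth_if: "axis i x $ k = (if k = i then x else 0)"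
  by (simp add: axis_def)

lemma mink_axis: "mink (axis i 1) v = (if i = 1 then - (v$i) else v$i)"
  using exhaust_4[of i] by (auto simp: mink_def axis_def)

lemma mink_nondegenerate: "(\<And>y. mink v y = 0) \<Longrightarrow> v = 0"
  by (metis (no_types, lifting) mink_axis mink_commute neg_equal_0_iff_equal vec_eq_iff zero_index)

text \<open>Orthogonality equates \<open>t$1 * y$1\<close> with the Euclidean product of the spatial
  parts. Cauchy-Schwarz bounds its square by \<open>T * Y\<close>, and \<open>T\<close> is smaller
  than the square of \<open>t$1\<close>.\<close>

lemma mink_reversed_time_like:
  assumes "mink t t < 0" "mink t y = 0" "y \<noteq> 0"
  shows "mink y y > 0"
proof -
  define T where "T = (t$2)\<^sup>2 + (t$3)\<^sup>2 + (t$4)\<^sup>2"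
  define Y where "Y = (y$2)\<^sup>2 + (y$3)\<^sup>2 + (y$4)\<^sup>2"
  have t: "T < (t$1)\<^sup>2" using assms(1) by (simp add: mink_def T_def power2_eq_square)
  have "Y \<ge> 0" "T \<ge> 0" by (simp_all add: Y_def T_def)
  have ty: "t$1 * y$1 = t$2 * y$2 + t$3 * y$3 + t$4 * y$4" using assms(2) by (simp add: mink_def)
  \<comment> \<open>Lagrange's identity: the defect in Cauchy-Schwarz as a sum of squares.\<close>
  have "T * Y - (t$2 * y$2 + t$3 * y$3 + t$4 * y$4)\<^sup>2
    = (t$2 * y$3 - t$3 * y$2)\<^sup>2 + (t$2 * y$4 - t$4 * y$2)\<^sup>2 + (t$3 * y$4 - t$4 * y$3)\<^sup>2"
    by (simp add: T_def Y_def power2_eq_square algebra_simps)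
  then have "(t$1 * y$1)\<^sup>2 \<le> T * Y"
    unfolding ty by (smt (verit) zero_le_power2)
  then have cs: "(t$1)\<^sup>2 * (y$1)\<^sup>2 \<le> T * Y" by (simp add: power_mult_distrib)
  have "(y$1)\<^sup>2 < Y"
  proof (rule ccontr)
    assume "\<not> (y$1)\<^sup>2 < Y"
    then have "(t$1)\<^sup>2 * (y$1)\<^sup>2 \<le> T * (y$1)\<^sup>2"
      using cs \<open>T \<ge> 0\<close> mult_left_mono[of Y "(y$1)\<^sup>2" T] by linarith
    then have "(y$1)\<^sup>2 = 0"
      using t by (smt (verit) mult_right_less_imp_less mult_strict_right_mono zero_le_power2 zero_less_power2)
    with \<open>\<not> (y$1)\<^sup>2 < Y\<close> \<open>Y \<ge> 0\<close> have "y$1 = 0" "Y = 0" by auto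
    then have "y = 0"
      unfolding vec_eq_iff forall_4 Y_def
      by (smt (verit) zero_le_power2 zero_eq_power2 zero_index)
    with assms(3) show False by simp
  qed
  then show ?thesis by (simp add: mink_def Y_def power2_eq_square)
qed

text \<open>The minus sign is the determinant of the matrix of the metric.\<close>

lemma det_mink_gram:
  "det (\<chi> i j. mink (a i) (b j)) = - (det (\<chi> i. a i) * det (\<chi> i. b i))" for a b :: "4 \<Rightarrow> real^4"
proof -
  define \<eta> :: "real^4^4" where "\<eta> = (\<chi> i j. if i = j then (if i = 1 then -1 else 1) else 0)"
  have "(\<chi> i j. mink (a i) (b j)) = (\<chi> i. a i) ** \<eta> ** transpose (\<chi> i. b i)"
    by (simp add: vec_eq_iff forall_4 matrix_matrix_mult_def sum_4 \<eta>_def transpose_def mink_def)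
  moreover have "det \<eta> = -1" by (simp add: det_4 \<eta>_def)
  ultimately show ?thesis by (simp add: det_mul det_transpose)
qed

section \<open>The Hodge star on bivectors and adapted orthonormal frames\<close>

definition frame4 :: "real^4 \<Rightarrow> real^4 \<Rightarrow> real^4 \<Rightarrow> real^4 \<Rightarrow> 4 \<Rightarrow> real^4" where
  "frame4 u v y z = (\<lambda>i. if i = 1 then u else if i = 2 then v else if i = 3 then y else z)"

lemma frame4_simps [simp]:
  "frame4 u v y z 1 = u" "frame4 u v y z 2 = v" "frame4 u v y z 3 = y" "frame4 u v y z 4 = z"
  by (simp_all add: frame4_def)

text \<open>The sign is chosen such that \<open>e 3 \<and>\<^sub>E e 4 = dual (e 1) (e 2)\<close> in an oriented orthonormal
  frame with space-like \<open>e 1\<close> and \<open>e 2\<close>; thus \<open>dual\<close> is a Hodge star.\<close>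

definition dual :: "real^4 \<Rightarrow> real^4 \<Rightarrow> real^4^4" where
  "dual u v = (\<chi> i j. - (mink (axis i 1) (axis i 1) * mink (axis j 1) (axis j 1)
      * det (\<chi> k. frame4 u v (axis i 1) (axis j 1) k)))"

text \<open>The opposite of the scalar product of bivectors: \<open>dual\<close> is an anti-isometry.\<close>

definition bivec_form :: "real^4^4 \<Rightarrow> real^4^4 \<Rightarrow> real" where
  "bivec_form M N = M$1$2 * N$1$2 + M$1$3 * N$1$3 + M$1$4 * N$1$4
     - M$2$3 * N$2$3 - M$2$4 * N$2$4 - M$3$4 * N$3$4"

lemma dual_nth:
  "dual u v $ 1 $ 2 = u$3 * v$4 - u$4 * v$3" "dual u v $ 1 $ 3 = u$4 * v$2 - u$2 * v$4"
  "dual u v $ 1 $ 4 = u$2 * v$3 - u$3 * v$2" "dual u v $ 2 $ 3 = u$4 * v$1 - u$1 * v$4"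
  "dual u v $ 2 $ 4 = u$1 * v$3 - u$3 * v$1" "dual u v $ 3 $ 4 = u$2 * v$1 - u$1 * v$2"
  by (simp_all add: dual_def det_4 mink_axis axis_nth_if)

interpretation dual: bounded_bilinear dual
proof -
  have "bilinear dual"
    unfolding bilinear_def
    by (auto intro!: linearI simp: vec_eq_iff dual_def det_4 algebra_simps)
  then show "bounded_bilinear dual" by (simp add: bilinear_conv_bounded_bilinear)
qed

lemmas dual_linear = dual.add_left dual.add_right dual.diff_left dual.diff_right
  dual.scaleR_left dual.scaleR_right dual.minus_left dual.minus_right dual.zero_left dual.zero_right

lemma dual_commute: "dual u v = - dual v u"
  by (simp add: vec_eq_iff dual_def det_4 algebra_simps)

lemma dual_same [simp]: "dual u u = 0"
  using dual_commute[of u u] by (simp add: vec_eq_iff)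

interpretation bivec_form: bounded_bilinear bivec_form
proof -
  have "bilinear bivec_form"
    unfolding bilinear_def by (auto intro!: linearI simp: bivec_form_def algebra_simps)
  then show "bounded_bilinear bivec_form" by (simp add: bilinear_conv_bounded_bilinear)
qed

lemma bivec_form_commute: "bivec_form M N = bivec_form N M"
  by (simp add: bivec_form_def mult.commute)

lemma bivec_form_dual:
  "bivec_form (dual u v) (dual w z) = mink u w * mink v z - mink u z * mink v w"
  by (simp add: bivec_form_def dual_nth mink_def algebra_simps)

text \<open>In the Gram matrix of \<open>e 1\<close>, \<open>e 2\<close>, \<open>y\<close>,
  \<open>z\<close> against \<open>e\<close> the first two rows are unit vectors, so its determinant
  is the minor of \<open>y\<close>, \<open>z\<close> against \<open>e 3\<close>, \<open>e 4\<close>.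
  By \<open>det_mink_gram\<close> it is also minus the determinant of the four vectors. Standard
  basis vectors in place of \<open>y\<close>, \<open>z\<close> read off the coordinates.\<close>

lemma wedge_eq_dual:
  assumes orth: "\<And>i j. i \<noteq> j \<Longrightarrow> mink (e i) (e j) = 0" and unit: "\<And>i. \<bar>mink (e i) (e i)\<bar> = 1"
    and pos: "mink (e 1) (e 1) = 1" "mink (e 2) (e 2) = 1" and det: "det (\<chi> i. e i) > 0"
  shows "e 3 \<and>\<^sub>E e 4 = dual (e 1) (e 2)"
proof -
  define d where "d = det (\<chi> i. e i)"
  \<comment> \<open>The left side is 1 or -1, so \<open>d * d\<close> is 1, and the orientation
    selects \<open>d = 1\<close>.\<close>
  have "mink (e 3) (e 3) * mink (e 4) (e 4) = - (d * d)"
    using det_mink_gram[of e e] pos by (simp add: det_4 orth d_def)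
  moreover have "\<bar>mink (e 3) (e 3) * mink (e 4) (e 4)\<bar> = 1" by (simp add: abs_mult unit)
  ultimately have "d * d = 1" by (simp add: abs_mult)
  with det have d: "d = 1" unfolding d_def by (metis less_asym neg_0_less_iff_less square_eq_1_iff zero_less_one)
  have *: "mink y (e 3) * mink z (e 4) - mink y (e 4) * mink z (e 3) = - det (\<chi> k. frame4 (e 1) (e 2) y z k)" for y z
    using det_mink_gram[of "frame4 (e 1) (e 2) y z" e] pos d
    unfolding d_def[symmetric] by (subst (asm) det_4) (simp add: orth mult.commute)
  have "(e 3 \<and>\<^sub>E e 4) $ i $ j = dual (e 1) (e 2) $ i $ j" for i j
    using *[of "axis i 1" "axis j 1"]
    by (cases "i = 1"; cases "j = 1") (simp_all add: wedge_def dual_def mink_axis axis_nth_if algebra_simps)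
  then show ?thesis by (simp add: vec_eq_iff)
qed

lemma orthonormal_completion:
  assumes "mink t1 t1 = 1" "mink t2 t2 = 1" "mink t1 t2 = 0"
  obtains e where "e 1 = t1" "e 2 = t2" "\<And>i j. i \<noteq> j \<Longrightarrow> mink (e i) (e j) = 0"
    "\<And>i. \<bar>mink (e i) (e i)\<bar> = 1" "det (\<chi> i. e i) > 0"
proof -
  \<comment> \<open>The time axis minus its projection to the plane is time-like, because removing
    space-like components only lowers its square.\<close>
  define a :: "real^4" where "a = axis 1 1"
  define n where "n = a - mink a t1 *\<^sub>R t1 - mink a t2 *\<^sub>R t2"
  have n12: "mink n t1 = 0" "mink n t2 = 0"
    using assms by (simp_all add: n_def mink_linear mink_commute[of t2 t1])
  have "mink a a = -1" by (simp add: a_def mink_axis)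
  then have "mink n n = -1 - (mink a t1)\<^sup>2 - (mink a t2)\<^sup>2"
    using assms by (simp add: n_def mink_linear mink_commute[of t2 t1] mink_commute[of t1 a] mink_commute[of t2 a] power2_eq_square)
  then have n: "mink n n < 0" by (smt (verit) zero_le_power2)
  \<comment> \<open>\<open>flip\<close> lowers an index: Minkowski orthogonality becomes Euclidean
    orthogonality, and a dimension count then provides \<open>m\<close>.\<close>
  define flip :: "real^4 \<Rightarrow> real^4" where "flip v = (\<chi> i. if i = 1 then - v$i else v$i)" for v
  have flip: "flip v \<bullet> y = mink v y" for v y
    by (simp add: inner_vec_def sum_4 flip_def mink_def)
  have "dim (span {flip t1, flip t2, flip n}) < DIM(real^4)"
    using dim_le_card'[of "{flip t1, flip t2, flip n}"] card_insert_le_m1[of 3 "{flip t2, flip n}"]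
    by (simp add: card_insert_if split: if_splits)
  then have "span {flip t1, flip t2, flip n} \<subset> UNIV"
    by (metis dim_UNIV less_irrefl top.not_eq_extremum)
  then obtain m where m: "m \<noteq> 0" "\<And>y. y \<in> span {flip t1, flip t2, flip n} \<Longrightarrow> orthogonal m y"
    using orthogonal_to_subspace_exists_gen[of "{flip t1, flip t2, flip n}" UNIV] by auto
  have m12: "mink t1 m = 0" "mink t2 m = 0" "mink n m = 0"
    using m(2)[of "flip t1"] m(2)[of "flip t2"] m(2)[of "flip n"]
    by (auto simp: span_base orthogonal_def inner_commute flip[symmetric])
  have mm: "mink m m > 0" using mink_reversed_time_like[OF n m12(3) m(1)] .
  define N where "N = (1 / sqrt (- mink n n)) *\<^sub>R n"
  \<comment> \<open>The sign \<open>s\<close> stays free so that the orientation can be corrected at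
    the end.\<close>
  define M where "M s = (s / sqrt (mink m m)) *\<^sub>R m" for s
  define e where "e s = frame4 t1 t2 (M s) N" for s
  have orth: "mink (e s i) (e s j) = 0" if "i \<noteq> j" for s i j
    using that exhaust_4[of i] exhaust_4[of j] n12 m12 assms(3) n12[unfolded mink_commute[of n]]
      m12[unfolded mink_commute[of _ m]] assms(3)[unfolded mink_commute[of t1 t2]]
    by (auto simp: e_def N_def M_def mink_linear)
  have unit: "\<bar>mink (e s i) (e s i)\<bar> = 1" if "\<bar>s\<bar> = 1" for s i
    using that exhaust_4[of i] assms n mm
    by (auto simp: e_def N_def M_def mink_linear abs_mult)
  have "det (\<chi> i. e 1 i) \<noteq> 0"
  proof
    assume "det (\<chi> i. e 1 i) = 0"
    then have "mink (e 1 1) (e 1 1) * (mink (e 1 2) (e 1 2) * (mink (e 1 3) (e 1 3) * mink (e 1 4) (e 1 4))) = 0"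
      using det_mink_gram[of "e 1" "e 1"] by (simp add: det_4 orth)
    then show False using unit[of 1] by (metis abs_0 abs_1 mult_eq_0_iff zero_neq_one)
  qed
  moreover have "det (\<chi> i. e (-1) i) = - det (\<chi> i. e 1 i)"
    by (simp add: det_4 e_def M_def algebra_simps)
  ultimately obtain s where "\<bar>s\<bar> = 1" "det (\<chi> i. e s i) > 0"
    by (metis abs_1 abs_minus_cancel neg_0_less_iff_less not_less_iff_gr_or_eq)
  with orth unit show ?thesis by (intro that[of "e s"]) (auto simp: e_def)
qed

section \<open>Orthonormally framed surface patches\<close>

lemma D_linear:
  assumes "F differentiable (at p)"
  shows "D (v + w) F p = D v F p + D w F p" "D (v - w) F p = D v F p - D w F p"
    "D (c *\<^sub>R v) F p = c *\<^sub>R D v F p" "D 0 F p = 0"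
proof -
  interpret linear "\<lambda>v. D v F p" by (rule linear_D[OF assms])
  show "D (v + w) F p = D v F p + D w F p" by (rule add)
  show "D (v - w) F p = D v F p - D w F p" by (rule diff)
  show "D (c *\<^sub>R v) F p = c *\<^sub>R D v F p" by (rule scale)
  show "D 0 F p = 0" by (rule zero)
qed

lemma push_eq_along: "push r X = along X r"
  by (simp add: push_def along_def fun_eq_iff)

lemma bilinear_second_derivative:
  fixes F :: "'a::euclidean_space \<Rightarrow> 'b::real_inner"
  assumes "open S" "smooth_on F S" "p \<in> S"
  shows "bilinear (\<lambda>x y. D x (D y F) p)"
  unfolding bilinear_def
proof (intro conjI allI)
  show "linear (\<lambda>x. D x (D y F) p)" for y
    by (rule linear_D) (rule smooth_on_differentiable[OF smooth_on_D[OF assms(2)] assms(3)])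
  then show "linear (\<lambda>y. D x (D y F) p)" for x
    by (subst D_commute[OF assms])
qed

lemma bilinearI:
  assumes "\<And>x y z. f (x + y) z = f x z + f y z" "\<And>x y z. f x (y + z) = f x y + f x z"
    "\<And>c x y. f (c *\<^sub>R x) y = c *\<^sub>R f x y" "\<And>c x y. f x (c *\<^sub>R y) = c *\<^sub>R f x y"
  shows "bilinear f"
  using assms by (auto simp: bilinear_def intro: linearI)

lemmas bilinear_simps = bilinear_ladd bilinear_radd bilinear_lmul bilinear_rmul

text \<open>For orthonormal \<open>x\<close>, \<open>y\<close> the coefficients are G, -2F and E,
  where E, F, G are the Gram entries of \<open>u\<close>, \<open>v\<close>. This is the metric trace
  in an arbitrary basis, multiplied by EG - F^2 so that no division occurs.\<close>

lemma bilinear_trace: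
  fixes \<beta> :: "'a::real_vector \<Rightarrow> 'a \<Rightarrow> 'b::real_inner"
  assumes "bilinear \<beta>" "u = a *\<^sub>R x + b *\<^sub>R y" "v = c *\<^sub>R x + d *\<^sub>R y" "\<beta> y x = \<beta> x y"
  shows "(c * c + d * d) *\<^sub>R \<beta> u u - (2 * (a * c + b * d)) *\<^sub>R \<beta> u v + (a * a + b * b) *\<^sub>R \<beta> v v
    = ((a * a + b * b) * (c * c + d * d) - (a * c + b * d)\<^sup>2) *\<^sub>R (\<beta> x x + \<beta> y y)" (is "?L = ?R")
proof -
  have "w \<bullet> ?L = w \<bullet> ?R" for w
    unfolding assms(2,3)
    by (simp add: bilinear_simps[OF assms(1)] assms(4) inner_simps) (simp add: algebra_simps power2_eq_square)
  then show ?thesis using vector_eq_ldot by blast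
qed

definition det2 :: "real^2 \<Rightarrow> real^2 \<Rightarrow> real" where
  "det2 u v = u$1 * v$2 - u$2 * v$1"

text \<open>Cramer's rule.\<close>

lemma det2_expand:
  assumes "det2 u v \<noteq> 0"
  shows "w = (det2 w v / det2 u v) *\<^sub>R u + (det2 u w / det2 u v) *\<^sub>R v"
proof -
  have "det2 u v *\<^sub>R w = det2 w v *\<^sub>R u + det2 u w *\<^sub>R v"
    by (simp add: vec_eq_iff forall_2 det2_def algebra_simps)
  from arg_cong[OF this, of "\<lambda>z. (1 / det2 u v) *\<^sub>R z"] show ?thesis
    using assms by (simp add: scaleR_right_distrib)
qed

text \<open>The bivectors of a plane form a line, so each \<open>dual\<close> is its
  \<open>det2\<close> times the one of the coordinate axes.\<close>

lemma dual_linear_image: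
  assumes "linear L"
  shows "det2 u v *\<^sub>R dual (L x) (L y) = det2 x y *\<^sub>R dual (L u) (L v)"
proof -
  have L: "L w = w$1 *\<^sub>R L (axis 1 1) + w$2 *\<^sub>R L (axis 2 1)" for w
  proof -
    have "w = w$1 *\<^sub>R axis 1 1 + w$2 *\<^sub>R axis 2 1"
      by (simp add: vec_eq_iff forall_2 axis_nth_if)
    from arg_cong[OF this, of L] show ?thesis
      by (simp add: linear_add[OF assms] linear_scale[OF assms])
  qed
  have "dual (L x) (L y) = det2 x y *\<^sub>R dual (L (axis 1 1)) (L (axis 2 1))" for x y
    by (subst L[of x], subst L[of y])
      (simp add: dual_linear dual_commute[of "L (axis 2 1)" "L (axis 1 1)"] det2_def algebra_simps)
  from this[of x y] this[of u v] show ?thesis by (simp add: mult.commute)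
qed

text \<open>\<open>e1\<close> and \<open>e2\<close> are in parameter components, while
  orthonormality concerns their images in Minkowski space. Space-likeness and injectivity of the
  differential are carried by the existence of this frame.\<close>

locale framed_surface =
  fixes r :: "real^2 \<Rightarrow> real^4" and U :: "(real^2) set" and e1 e2 :: "real^2 \<Rightarrow> real^2"
  assumes open_U: "open U" and smooth_r: "smooth_on r U"
    and smooth_e1: "smooth_on e1 U" and smooth_e2: "smooth_on e2 U"
    and orthonormal: "\<And>q. q \<in> U \<Longrightarrow> mink (along e1 r q) (along e1 r q) = 1"
      "\<And>q. q \<in> U \<Longrightarrow> mink (along e2 r q) (along e2 r q) = 1"
      "\<And>q. q \<in> U \<Longrightarrow> mink (along e1 r q) (along e2 r q) = 0"
    and oriented: "\<And>q. q \<in> U \<Longrightarrow> det2 (e1 q) (e2 q) > 0"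
begin

abbreviation "t1 \<equiv> along e1 r"
abbreviation "t2 \<equiv> along e2 r"

abbreviation "N \<equiv> nor_part r"

text \<open>Tangential projection followed by the inverse of the differential, as an explicit
  formula that is smooth in \<open>q\<close>; it replaces the descriptions in
  \<open>tan_part\<close> and \<open>nabla\<close>.\<close>

definition pull :: "real^2 \<Rightarrow> real^4 \<Rightarrow> real^2" where
  "pull q y = mink y (t1 q) *\<^sub>R e1 q + mink y (t2 q) *\<^sub>R e2 q"

abbreviation hess :: "real^2 \<Rightarrow> real^2 \<Rightarrow> real^2 \<Rightarrow> real^4" where
  "hess q x y \<equiv> D x (D y r) q"

lemma orthonormal': "q \<in> U \<Longrightarrow> mink (t2 q) (t1 q) = 0"
  by (subst mink_commute) (rule orthonormal(3))

lemma diff_r: "q \<in> U \<Longrightarrow> r differentiable (at q)"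
  using smooth_r smooth_on_differentiable by blast

lemma smooth_t: "smooth_on t1 U" "smooth_on t2 U"
  by (rule smooth_on_along[OF open_U smooth_r smooth_e1], rule smooth_on_along[OF open_U smooth_r smooth_e2])

lemmas Dr_linear = D_linear[OF diff_r]

lemma bilinear_hess: "q \<in> U \<Longrightarrow> bilinear (hess q)"
  by (rule bilinear_second_derivative[OF open_U smooth_r])

lemma hess_commute: "q \<in> U \<Longrightarrow> hess q x y = hess q y x"
  by (rule D_commute[OF open_U smooth_r])

section \<open>Tangential and normal projections in the frame\<close>

lemma D_pull: "q \<in> U \<Longrightarrow> D (pull q y) r q = mink y (t1 q) *\<^sub>R t1 q + mink y (t2 q) *\<^sub>R t2 q"
  by (simp add: pull_def Dr_linear along_eq_D[of e1] along_eq_D[of e2])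

lemma pull_D:
  assumes "q \<in> U"
  shows "pull q (D w r q) = w"
proof -
  obtain a b where w: "w = a *\<^sub>R e1 q + b *\<^sub>R e2 q"
    using det2_expand[of "e1 q" "e2 q" w] oriented[OF assms] by (metis less_irrefl)
  have "D w r q = a *\<^sub>R t1 q + b *\<^sub>R t2 q"
    using assms w by (simp add: Dr_linear along_eq_D[of e1] along_eq_D[of e2])
  then show ?thesis
    using w orthonormal[OF assms] orthonormal'[OF assms] by (simp add: pull_def mink_linear)
qed

lemma pull_linear: "pull q (a *\<^sub>R y + b *\<^sub>R z) = a *\<^sub>R pull q y + b *\<^sub>R pull q z"
  "pull q (y + z) = pull q y + pull q z" "pull q (a *\<^sub>R y) = a *\<^sub>R pull q y"
  "pull q 0 = 0"
  by (simp_all add: pull_def mink_linear algebra_simps)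

lemma tangent_plane_eq: "tangent_plane r q = range (\<lambda>w. D w r q)"
  by (simp add: tangent_plane_def along_def)

lemma normal_plane_iff: "n \<in> normal_plane r q \<longleftrightarrow> (\<forall>w. mink n (D w r q) = 0)"
  by (auto simp: normal_plane_def tangent_plane_eq)

lemma mink_D_pull:
  assumes "q \<in> U"
  shows "mink (D (pull q y) r q) (D w r q) = mink y (D w r q)"
proof -
  have "D w r q = mink (D w r q) (t1 q) *\<^sub>R t1 q + mink (D w r q) (t2 q) *\<^sub>R t2 q"
    using D_pull[OF assms, of "D w r q"] pull_D[OF assms] by simp
  then obtain a b where "D w r q = a *\<^sub>R t1 q + b *\<^sub>R t2 q" by blast
  then show ?thesis
    using assms by (simp add: D_pull mink_linear orthonormal orthonormal')
qed

lemma tan_part_eq: "q \<in> U \<Longrightarrow> tan_part r q y = D (pull q y) r q"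
  unfolding tan_part_def
proof (rule the_equality)
  assume q: "q \<in> U"
  show "D (pull q y) r q \<in> tangent_plane r q \<and> y - D (pull q y) r q \<in> normal_plane r q"
    by (auto simp: tangent_plane_eq normal_plane_iff mink_linear mink_D_pull[OF q])
  fix t assume t: "t \<in> tangent_plane r q \<and> y - t \<in> normal_plane r q"
  then obtain w where w: "t = D w r q" by (auto simp: tangent_plane_eq)
  have "mink (y - t) (t1 q) = 0" "mink (y - t) (t2 q) = 0"
    using t by (simp_all add: normal_plane_iff along_eq_D[of e1] along_eq_D[of e2])
  then have "pull q y = pull q t" by (simp add: pull_def mink_linear)
  also have "\<dots> = w" using pull_D[OF q] w by simp
  finally show "t = D (pull q y) r q" using w by simp
qed

lemma N_eq: "q \<in> U \<Longrightarrow> N q y = y - D (pull q y) r q"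
  by (simp add: nor_part_def tan_part_eq)

lemma N_eq': "q \<in> U \<Longrightarrow> N q y = y - mink y (t1 q) *\<^sub>R t1 q - mink y (t2 q) *\<^sub>R t2 q"
  by (simp add: N_eq D_pull)

lemma N_linear:
  assumes "q \<in> U"
  shows "N q (y + z) = N q y + N q z" "N q (y - z) = N q y - N q z" "N q (a *\<^sub>R y) = a *\<^sub>R N q y"
    "N q (- y) = - N q y" "N q 0 = 0"
  using assms by (simp_all add: N_eq' mink_linear algebra_simps)

lemma N_D [simp]: "q \<in> U \<Longrightarrow> N q (D w r q) = 0"
  by (simp add: N_eq pull_D)

lemma N_normal: "q \<in> U \<Longrightarrow> n \<in> normal_plane r q \<Longrightarrow> N q n = n"
  by (simp add: N_eq' normal_plane_iff along_eq_D[of e1] along_eq_D[of e2])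

lemma N_in_normal: "q \<in> U \<Longrightarrow> N q y \<in> normal_plane r q"
  by (simp add: N_eq normal_plane_iff mink_linear mink_D_pull)

lemma mink_N_D [simp]: "q \<in> U \<Longrightarrow> mink (N q y) (D w r q) = 0" "q \<in> U \<Longrightarrow> mink (D w r q) (N q y) = 0"
  using N_in_normal[of q y] by (simp_all add: normal_plane_iff mink_commute[of "D w r q"])

lemma mink_N_normal: "q \<in> U \<Longrightarrow> n \<in> normal_plane r q \<Longrightarrow> mink (N q y) n = mink y n"
  by (simp add: N_eq normal_plane_iff mink_linear mink_commute[of _ n])

lemma mink_N_N: "q \<in> U \<Longrightarrow> mink (N q y) (N q z) = mink y (N q z)"
  by (simp add: mink_N_normal N_in_normal)

lemma inj_Dr: "q \<in> U \<Longrightarrow> inj (\<lambda>w. D w r q)"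
  by (rule inj_on_inverseI[of _ "pull q"]) (simp add: pull_D)

lemma nabla_eq:
  assumes "q \<in> U"
  shows "nabla r X Y q = pull q (along X (along Y r) q)"
proof -
  have "inv (frechet_derivative r (at q)) (D w r q) = w" for w
    using inv_f_f[OF inj_Dr[OF assms], of w] by (simp add: along_def)
  then show ?thesis by (simp add: nabla_def push_eq_along tan_part_eq[OF assms])
qed

lemma along_along_r: "q \<in> U \<Longrightarrow> Y differentiable (at q) \<Longrightarrow> along X (along Y r) q = D (along X Y q) r q + hess q (X q) (Y q)"
  by (rule along_along[OF open_U smooth_r])

text \<open>The term with the derivative of \<open>Y\<close> is tangent and is killed by the normal
  projection, whence tensoriality.\<close>

lemma second_ff_eq: "q \<in> U \<Longrightarrow> Y differentiable (at q) \<Longrightarrow> second_ff r X Y q = N q (hess q (X q) (Y q))"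
  by (simp add: second_ff_def push_eq_along along_along_r[of q Y X] N_linear)

text \<open>Used in two ways: with an orthonormal pair it shows that traces do not depend on the
  frame; with constant \<open>u\<close>, \<open>v\<close> and varying \<open>q\<close> it expresses
  maximality through partial derivatives.\<close>

lemma trace:
  fixes \<beta> :: "real^2 \<Rightarrow> real^2 \<Rightarrow> 'b::real_inner"
  assumes "q \<in> U" "bilinear \<beta>" "\<And>x y. \<beta> x y = \<beta> y x"
  shows "mink (D v r q) (D v r q) *\<^sub>R \<beta> u u - (2 * mink (D u r q) (D v r q)) *\<^sub>R \<beta> u v + mink (D u r q) (D u r q) *\<^sub>R \<beta> v v
    = (mink (D u r q) (D u r q) * mink (D v r q) (D v r q) - (mink (D u r q) (D v r q))\<^sup>2)
       *\<^sub>R (\<beta> (e1 q) (e1 q) + \<beta> (e2 q) (e2 q))"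
proof -
  define a b c d where "a = mink (D u r q) (t1 q)" and "b = mink (D u r q) (t2 q)"
    and "c = mink (D v r q) (t1 q)" and "d = mink (D v r q) (t2 q)"
  have u: "u = a *\<^sub>R e1 q + b *\<^sub>R e2 q" and v: "v = c *\<^sub>R e1 q + d *\<^sub>R e2 q"
    unfolding a_def b_def c_def d_def
    by (rule pull_D[OF assms(1), unfolded pull_def, symmetric])+
  have "D u r q = a *\<^sub>R t1 q + b *\<^sub>R t2 q" "D v r q = c *\<^sub>R t1 q + d *\<^sub>R t2 q"
    unfolding a_def b_def c_def d_def
    by (rule D_pull[OF assms(1), of "D _ r q", unfolded pull_D[OF assms(1)]])+
  then have "mink (D u r q) (D u r q) = a * a + b * b" "mink (D u r q) (D v r q) = a * c + b * d"
    "mink (D v r q) (D v r q) = c * c + d * d"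
    using orthonormal[OF assms(1)] orthonormal'[OF assms(1)] by (simp_all add: mink_linear)
  then show ?thesis using bilinear_trace[OF assms(2) u v assms(3)] by simp
qed

section \<open>Mean curvature and Laplacian in an arbitrary orthonormal frame\<close>

lemma orthonormal_trace:
  fixes \<beta> :: "real^2 \<Rightarrow> real^2 \<Rightarrow> 'b::real_inner"
  assumes "q \<in> U" "bilinear \<beta>" "\<And>x y. \<beta> x y = \<beta> y x" "orthonormal_frame r V e" "q \<in> V"
  shows "(\<Sum>i\<in>UNIV. \<beta> (e i q) (e i q)) = \<beta> (e1 q) (e1 q) + \<beta> (e2 q) (e2 q)"
  using trace[OF assms(1-3), of "e 2 q" "e 1 q"] assms(4,5)
  by (simp add: orthonormal_frame_def metric_def push_eq_along sum_2 along_eq_D[of "e _"])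

lemma frame_differentiable: "orthonormal_frame r V e \<Longrightarrow> q \<in> V \<Longrightarrow> e i differentiable (at q)"
  unfolding orthonormal_frame_def using smooth_on_differentiable by blast

lemma orthonormal_frame_self: "orthonormal_frame r U (\<lambda>i. if i = 1 then e1 else e2)"
  using smooth_e1 smooth_e2 orthonormal orthonormal'
  by (auto simp: orthonormal_frame_def forall_2 metric_def push_eq_along)

text \<open>The trace of \<open>hess p\<close> is the same in every frame, so the description in
  \<open>mean_curv\<close> has one solution; the frame of the locale witnesses it.\<close>

lemma mean_curv_eq:
  assumes "p \<in> U"
  shows "mean_curv r p = (1/2) *\<^sub>R N p (hess p (e1 p) (e1 p) + hess p (e2 p) (e2 p))"
proof -
  have *: "(\<Sum>i\<in>UNIV. second_ff r (e i) (e i) p) = N p (hess p (e1 p) (e1 p) + hess p (e2 p) (e2 p))"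
    if "orthonormal_frame r V e" "p \<in> V" for V e
    using orthonormal_trace[OF assms bilinear_hess[OF assms] hess_commute[OF assms] that, symmetric] assms that
    by (simp add: second_ff_eq frame_differentiable sum_2 N_linear)
  show ?thesis
    unfolding mean_curv_def
  proof (rule the_equality)
    show "\<exists>V e. open V \<and> p \<in> V \<and> orthonormal_frame r V e \<and>
        (1/2) *\<^sub>R N p (hess p (e1 p) (e1 p) + hess p (e2 p) (e2 p)) = (1/2) *\<^sub>R (\<Sum>i\<in>UNIV. second_ff r (e i) (e i) p)"
      using *[OF orthonormal_frame_self assms] orthonormal_frame_self open_U assms
      by (intro exI[of _ U] exI[of _ "\<lambda>i. if i = 1 then e1 else e2"]) simp
    fix H assume "\<exists>V e. open V \<and> p \<in> V \<and> orthonormal_frame r V e \<and>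
        H = (1/2) *\<^sub>R (\<Sum>i\<in>UNIV. second_ff r (e i) (e i) p)"
    then show "H = (1/2) *\<^sub>R N p (hess p (e1 p) (e1 p) + hess p (e2 p) (e2 p))"
      using * by (elim exE conjE) simp
  qed
qed

lemma laplacian_eq:
  fixes F :: "real^2 \<Rightarrow> 'b::real_inner"
  assumes "p \<in> U" "smooth_on F U"
  shows "laplacian r F p = D (pull p (hess p (e1 p) (e1 p) + hess p (e2 p) (e2 p))) F p
     - (D (e1 p) (D (e1 p) F) p + D (e2 p) (D (e2 p) F) p)"
proof -
  \<comment> \<open>Minus the covariant Hessian of \<open>F\<close>.\<close>
  let ?\<beta> = "\<lambda>x y. D (pull p (hess p x y)) F p - D x (D y F) p"
  note lin = D_linear[OF smooth_on_differentiable[OF assms(2,1)]]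
  note h1 = bilinear_simps[OF bilinear_hess[OF assms(1)]]
  note h2 = bilinear_simps[OF bilinear_second_derivative[OF open_U assms(2,1)]]
  have bil: "bilinear ?\<beta>"
    by (rule bilinearI) (simp_all add: h1 h2 pull_linear lin algebra_simps)
  have sym: "?\<beta> x y = ?\<beta> y x" for x y
    by (simp only: hess_commute[OF assms(1), of x y] D_commute[OF open_U assms(2,1), of x y])
  \<comment> \<open>The derivative of \<open>X\<close> occurs in both terms and cancels, so only the
    value \<open>X p\<close> matters.\<close>
  have summand: "along (nabla r X X) F p - along X (along X F) p = ?\<beta> (X p) (X p)"
    if "X differentiable (at p)" for X
    using along_along[OF open_U assms(2,1) that, of X] nabla_eq[OF assms(1), of X X]
      along_along_r[OF assms(1) that, of X]
    by (simp add: along_eq_D[of "nabla r X X"] pull_linear pull_D[OF assms(1)] lin)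
  have *: "(\<Sum>i\<in>UNIV. along (nabla r (e i) (e i)) F p - along (e i) (along (e i) F) p)
      = ?\<beta> (e1 p) (e1 p) + ?\<beta> (e2 p) (e2 p)"
    if "orthonormal_frame r V e" "p \<in> V" for V e
    using orthonormal_trace[OF assms(1) bil sym that] summand frame_differentiable[OF that] by simp
  have "laplacian r F p = ?\<beta> (e1 p) (e1 p) + ?\<beta> (e2 p) (e2 p)"
    unfolding laplacian_def
  proof (rule the_equality)
    show "\<exists>V e. open V \<and> p \<in> V \<and> orthonormal_frame r V e \<and> ?\<beta> (e1 p) (e1 p) + ?\<beta> (e2 p) (e2 p)
        = (\<Sum>i\<in>UNIV. along (nabla r (e i) (e i)) F p - along (e i) (along (e i) F) p)"
      using *[OF orthonormal_frame_self assms(1)] orthonormal_frame_self open_U assms(1)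
      by (intro exI[of _ U] exI[of _ "\<lambda>i. if i = 1 then e1 else e2"]) simp
    fix L assume "\<exists>V e. open V \<and> p \<in> V \<and> orthonormal_frame r V e \<and>
        L = (\<Sum>i\<in>UNIV. along (nabla r (e i) (e i)) F p - along (e i) (along (e i) F) p)"
    then obtain V e where "p \<in> V" "orthonormal_frame r V e"
      "L = (\<Sum>i\<in>UNIV. along (nabla r (e i) (e i)) F p - along (e i) (along (e i) F) p)" by blast
    with *[of V e] show "L = ?\<beta> (e1 p) (e1 p) + ?\<beta> (e2 p) (e2 p)" by simp
  qed
  then show ?thesis by (simp add: pull_linear lin)
qed

end

section \<open>The Laplacian of the Gauss map\<close>

text \<open>Modulo \<open>dual R1 R2\<close>, every product of \<open>R1\<close> or
  \<open>R2\<close> with \<open>A\<close> or \<open>C\<close> cancels. The 4 arises from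
  \<open>dual Ruu Ruv\<close> and \<open>dual Ruv Rvv\<close>: each contains \<open>dual A C\<close>
  once and carries a factor 2. \<open>R1\<close>, \<open>R2\<close> stand for first derivatives of
  \<open>r\<close>, \<open>P1\<close>, \<open>P2\<close> for sums of third derivatives, and
  \<open>fu\<close>, \<open>fv\<close>, \<open>ff\<close> for derivatives of the scalar
  factor.\<close>

lemma gauss_laplacian_algebra:
  assumes "Ruu = x1 *\<^sub>R R1 + x2 *\<^sub>R R2 + A" "Ruv = y1 *\<^sub>R R1 + y2 *\<^sub>R R2 + C" "Rvv = z1 *\<^sub>R R1 + z2 *\<^sub>R R2 - A"
    and "P1 = - (2 * y2) *\<^sub>R Ruu + (2 * (x2 + y1)) *\<^sub>R Ruv - (2 * x1) *\<^sub>R Rvv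
         + (k1 *\<^sub>R R1 + k2 *\<^sub>R R2) + ((x1 + z1) *\<^sub>R Ruu + (x2 + z2) *\<^sub>R Ruv)"
    and "P2 = - (2 * z2) *\<^sub>R Ruu + (2 * (y2 + z1)) *\<^sub>R Ruv - (2 * y1) *\<^sub>R Rvv
         + (l1 *\<^sub>R R1 + l2 *\<^sub>R R2) + ((x1 + z1) *\<^sub>R Ruv + (x2 + z2) *\<^sub>R Rvv)"
    and "Bu = dual R1 Ruv + dual Ruu R2" "Bv = dual R1 Rvv + dual Ruv R2"
    and "fu = - (x1 + y2)" "fv = - (y1 + z2)"
  shows "\<exists>c. (x1 + z1) *\<^sub>R (Bu + fu *\<^sub>R dual R1 R2) + (x2 + z2) *\<^sub>R (Bv + fv *\<^sub>R dual R1 R2)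
      - (dual P1 R2 + dual R1 P2 + 2 *\<^sub>R dual Ruu Ruv + 2 *\<^sub>R dual Ruv Rvv
         + 2 *\<^sub>R fu *\<^sub>R Bu + 2 *\<^sub>R fv *\<^sub>R Bv + ff *\<^sub>R dual R1 R2)
      = c *\<^sub>R dual R1 R2 - 4 *\<^sub>R dual A C" (is "\<exists>c. ?L = _")
proof
  \<comment> \<open>The collected coefficient of \<open>dual R1 R2\<close>; only its existence is
    exported, its value follows later from the constant length.\<close>
  let ?c = "(x1 + z1) * (x1 + y2 + fu) + (x2 + z2) * (y1 + z2 + fv)
    - (- (2 * y2) * x1 + (2 * (x2 + y1)) * y1 - (2 * x1) * z1 + k1 + ((x1 + z1) * x1 + (x2 + z2) * y1)
       - (2 * z2) * x2 + (2 * (y2 + z1)) * y2 - (2 * y1) * z2 + l2 + ((x1 + z1) * y2 + (x2 + z2) * z2)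
       + 2 * (x1 * y2 - x2 * y1) + 2 * (y1 * z2 - y2 * z1)
       + 2 * fu * (x1 + y2) + 2 * fv * (y1 + z2) + ff)"
  show "?L = ?c *\<^sub>R dual R1 R2 - 4 *\<^sub>R dual A C"
    unfolding assms(4-7) unfolding assms(1-3,8,9)
    by (simp add: dual_linear dual_commute[of R2 R1] dual_commute[of A R1] dual_commute[of A R2]
        dual_commute[of C R1] dual_commute[of C R2] dual_commute[of C A] vec_eq_iff)
       (simp add: algebra_simps)
qed

context framed_surface
begin

definition h11 :: "real^2 \<Rightarrow> real^4" where "h11 p = N p (hess p (e1 p) (e1 p))"
definition h12 :: "real^2 \<Rightarrow> real^4" where "h12 p = N p (hess p (e1 p) (e2 p))"
text \<open>Local form of the Gauss map without normal vectors, visibly smooth;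
  \<open>gauss_map_chart\<close> identifies it with the description.\<close>

definition gauss :: "real^2 \<Rightarrow> real^4^4" where "gauss q = dual (t1 q) (t2 q)"

lemma smooth_gauss: "smooth_on gauss U"
  unfolding gauss_def by (rule dual.smooth_on[OF open_U smooth_t])

lemma bivec_form_gauss: "q \<in> U \<Longrightarrow> bivec_form (gauss q) (gauss q) = 1"
  by (simp add: gauss_def bivec_form_dual orthonormal orthonormal')

lemma smooth_Dr: "smooth_on (D w r) U" "smooth_on (D v (D w r)) U"
  using smooth_on_D smooth_r by blast+

lemma diff_Dr: "q \<in> U \<Longrightarrow> D w r differentiable (at q)" "q \<in> U \<Longrightarrow> D v (D w r) differentiable (at q)"
  using smooth_on_differentiable smooth_Dr by blast+

lemma D_gauss_orthogonal:
  assumes "q \<in> U"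
  shows "bivec_form (D w gauss q) (gauss q) = 0"
proof -
  have g: "gauss differentiable (at q)" using smooth_on_differentiable[OF smooth_gauss assms] .
  have "D w (\<lambda>q. bivec_form (gauss q) (gauss q)) q = 0"
    using along_cong_open[OF open_U assms, of "\<lambda>q. bivec_form (gauss q) (gauss q)" "\<lambda>_. 1"] bivec_form_gauss by simp
  then show ?thesis
    using bivec_form.along_prod[OF g g, of "\<lambda>_. w"] bivec_form_commute[of "gauss q"] by simp
qed

text \<open>The constant length differentiated twice. It reduces the product of the Laplacian with
  \<open>gauss\<close> to first derivatives.\<close>

lemma DD_gauss_gauss:
  assumes "q \<in> U"
  shows "bivec_form (D w (D w gauss) q) (gauss q) = - bivec_form (D w gauss q) (D w gauss q)"
proof -
  have g: "gauss differentiable (at q)" "D w gauss differentiable (at q)"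
    using smooth_on_differentiable[OF smooth_gauss assms] smooth_on_differentiable[OF smooth_on_D[OF smooth_gauss] assms] .
  have "D w (\<lambda>q. bivec_form (D w gauss q) (gauss q)) q = 0"
    using along_cong_open[OF open_U assms, of "\<lambda>q. bivec_form (D w gauss q) (gauss q)" "\<lambda>_. 0"] D_gauss_orthogonal by simp
  then show ?thesis
    using bivec_form.along_prod[OF g(2,1), of "\<lambda>_. w"] by simp
qed

text \<open>With the directions frozen at \<open>p\<close>, the frame fields survive only in a
  scalar factor.\<close>

lemma gauss_eq_coordinates:
  assumes "p \<in> U" "q \<in> U"
  shows "gauss q = (det2 (e1 q) (e2 q) / det2 (e1 p) (e2 p)) *\<^sub>R dual (D (e1 p) r q) (D (e2 p) r q)"
proof -
  have "linear (\<lambda>w. D w r q)" by (rule linear_D[OF diff_r[OF assms(2)]])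
  from dual_linear_image[OF this, of "e1 p" "e2 p" "e1 q" "e2 q"]
  have "det2 (e1 p) (e2 p) *\<^sub>R gauss q = det2 (e1 q) (e2 q) *\<^sub>R dual (D (e1 p) r q) (D (e2 p) r q)"
    by (simp add: gauss_def along_eq_D[of e1] along_eq_D[of e2])
  from arg_cong[OF this, of "\<lambda>z. (1 / det2 (e1 p) (e2 p)) *\<^sub>R z"] oriented[OF assms(1)]
  show ?thesis by simp
qed

lemma smooth_det2: "smooth_on (\<lambda>q. det2 (e1 q) (e2 q)) U"
  unfolding det2_def using smooth_e1 smooth_e2
  by (intro smooth_on_diff smooth_on_mult open_U bounded_linear.smooth_on[OF bounded_linear_vec_nth])

text \<open>Differentiating the condition that \<open>G r\<^sub>u\<^sub>u - 2 F r\<^sub>u\<^sub>v + E r\<^sub>v\<^sub>v\<close> is tangent takes the place of the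
  Codazzi equation.\<close>

lemma maximal_third_derivative:
  assumes "p \<in> U" and max: "\<And>q. q \<in> U \<Longrightarrow> mean_curv r q = 0"
  defines "u \<equiv> e1 p" and "v \<equiv> e2 p"
  shows "\<exists>k1 k2. D w (D u (D u r)) p + D w (D v (D v r)) p =
      - (2 * mink (D v r p) (hess p w v)) *\<^sub>R hess p u u
      + (2 * (mink (hess p w u) (D v r p) + mink (D u r p) (hess p w v))) *\<^sub>R hess p u v
      - (2 * mink (D u r p) (hess p w u)) *\<^sub>R hess p v v
      + (k1 *\<^sub>R D u r p + k2 *\<^sub>R D v r p)
      + hess p w (pull p (hess p u u + hess p v v))"
proof -
  define G where "G q = mink (D v r q) (D v r q)" for q
  define F where "F q = mink (D u r q) (D v r q)" for q
  define E where "E q = mink (D u r q) (D u r q)" for q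
  define S where "S q = G q *\<^sub>R hess q u u - (2 * F q) *\<^sub>R hess q u v + E q *\<^sub>R hess q v v" for q
  define Z where "Z q = pull q (S q)" for q
  have smooth_EFG: "smooth_on E U" "smooth_on F U" "smooth_on G U"
    unfolding E_def F_def G_def by (intro mink.smooth_on open_U smooth_Dr)+
  have smooth_S: "smooth_on S U"
    unfolding S_def
    by (intro smooth_on_add smooth_on_diff smooth_on_scaleR smooth_on_mult smooth_on_const open_U smooth_Dr smooth_EFG)
  have smooth_Z: "smooth_on Z U"
    unfolding Z_def pull_def
    by (intro smooth_on_add smooth_on_scaleR mink.smooth_on open_U smooth_S smooth_t smooth_e1 smooth_e2)
  \<comment> \<open>By the trace formula the normal part of \<open>S q\<close> is a multiple of the
    mean curvature. The identity holds on all of \<open>U\<close>, so it can be differentiated at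
    \<open>p\<close>.\<close>
  have "S q = along Z r q" if q: "q \<in> U" for q
  proof -
    have "N q (hess q (e1 q) (e1 q) + hess q (e2 q) (e2 q)) = 0"
      using mean_curv_eq[OF q] max[OF q] by simp
    moreover have "S q = (E q * G q - (F q)\<^sup>2) *\<^sub>R (hess q (e1 q) (e1 q) + hess q (e2 q) (e2 q))"
      unfolding S_def E_def F_def G_def by (rule trace[OF q bilinear_hess[OF q] hess_commute[OF q]])
    ultimately have "N q (S q) = 0" by (simp add: N_linear[OF q])
    then show ?thesis by (simp add: N_eq[OF q] Z_def along_eq_D[of Z] along_eq_D[of "\<lambda>q. pull q (S q)"])
  qed
  then have "D w S p = D w (along Z r) p" by (rule along_cong_open[OF open_U assms(1)])
  also have "\<dots> = D (D w Z p) r p + hess p w (Z p)"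
    using along_along_r[OF assms(1) smooth_on_differentiable[OF smooth_Z assms(1)], of "\<lambda>_. w"] .
  finally have DS: "D w S p = D (D w Z p) r p + hess p w (Z p)" .
  \<comment> \<open>\<open>u\<close> and \<open>v\<close> are orthonormal at \<open>p\<close> only,
    so the derivatives of \<open>E\<close>, \<open>F\<close>, \<open>G\<close> still
    contribute.\<close>
  have at_p: "E p = 1" "F p = 0" "G p = 1"
    using orthonormal[OF assms(1)] by (simp_all add: E_def F_def G_def u_def v_def along_eq_D[of e1] along_eq_D[of e2])
  have diffs: "E differentiable at p" "F differentiable at p" "G differentiable at p"
    using smooth_EFG smooth_on_differentiable assms(1) by blast+
  have diff2F: "(\<lambda>q. 2 * F q) differentiable at p"
    using diffs by simp
  note sc = bounded_bilinear.along_prod[OF bounded_bilinear_scaleR]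
  have d2: "(\<lambda>q. c q *\<^sub>R hess q a b) differentiable at p" if "c differentiable at p" for c a b
    using that diff_Dr[OF assms(1)] by simp
  have "D w S p = G p *\<^sub>R D w (D u (D u r)) p + D w G p *\<^sub>R hess p u u
      - ((2 * F p) *\<^sub>R D w (D u (D v r)) p + (2 * D w F p) *\<^sub>R hess p u v)
      + (E p *\<^sub>R D w (D v (D v r)) p + D w E p *\<^sub>R hess p v v)"
  proof -
    have "D w (\<lambda>q. 2 * F q) p = 2 * D w F p"
      using bounded_linear.along_image[OF bounded_linear_mult_right[of 2] diffs(2)] .
    then show ?thesis
      unfolding S_def
      by (simp add: along_add along_diff d2 diffs diff2F sc diff_Dr[OF assms(1)] differentiable_diff)
  qed
  moreover have "D w E p = 2 * mink (D u r p) (hess p w u)" "D w G p = 2 * mink (D v r p) (hess p w v)"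
    "D w F p = mink (D u r p) (hess p w v) + mink (hess p w u) (D v r p)"
    unfolding E_def F_def G_def
    by (simp_all add: mink.along_prod diff_Dr[OF assms(1)] mink_commute[of "hess p w _"])
  moreover have "Z p = pull p (hess p u u + hess p v v)" by (simp add: Z_def S_def at_p)
  \<comment> \<open>The derivative of \<open>Z\<close> enters only through a tangent vector, which
    later adds just a multiple of the Gauss map; its coordinates can stay unknown.\<close>
  moreover obtain k1 k2 where "D (D w Z p) r p = k1 *\<^sub>R D u r p + k2 *\<^sub>R D v r p"
    using D_pull[OF assms(1), of "D (D w Z p) r p", unfolded pull_D[OF assms(1)]]
    unfolding u_def v_def along_eq_D[of e1] along_eq_D[of e2] by blast
  ultimately have "D w (D u (D u r)) p + D w (D v (D v r)) p =
      - (2 * mink (D v r p) (hess p w v)) *\<^sub>R hess p u u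
      + (2 * (mink (hess p w u) (D v r p) + mink (D u r p) (hess p w v))) *\<^sub>R hess p u v
      - (2 * mink (D u r p) (hess p w u)) *\<^sub>R hess p v v
      + (k1 *\<^sub>R D u r p + k2 *\<^sub>R D v r p)
      + hess p w (pull p (hess p u u + hess p v v))"
    using DS by (simp add: at_p algebra_simps)
  then show ?thesis by blast
qed

text \<open>Moves \<open>b\<close> outside, so that the second derivatives of \<open>D b r\<close>
  become derivatives of the trace treated in \<open>maximal_third_derivative\<close>.\<close>

lemma third_derivative_commute:
  assumes "p \<in> U"
  shows "D a (D a (D b r)) p = D b (D a (D a r)) p"
proof -
  have "D a (D a (D b r)) p = D a (D b (D a r)) p"
    by (rule along_cong_open[OF open_U assms]) (rule hess_commute)
  also have "\<dots> = D b (D a (D a r)) p"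
    by (rule D_commute[OF open_U smooth_Dr(1) assms])
  finally show ?thesis .
qed

lemma maximal_trace: "p \<in> U \<Longrightarrow> mean_curv r p = 0 \<Longrightarrow> N p (hess p (e2 p) (e2 p)) = - h11 p"
  by (simp add: mean_curv_eq N_linear h11_def eq_neg_iff_add_eq_0 add.commute)

lemma laplacian_gauss:
  assumes p: "p \<in> U" and max: "\<And>q. q \<in> U \<Longrightarrow> mean_curv r q = 0"
  shows "laplacian r gauss p
    = (2 * (mink (h11 p) (h11 p) + mink (h12 p) (h12 p))) *\<^sub>R gauss p - 4 *\<^sub>R dual (h11 p) (h12 p)"
proof -
  define u v where "u = e1 p" and "v = e2 p"
  define R1 R2 where "R1 = D u r p" and "R2 = D v r p"
  have R: "t1 p = R1" "t2 p = R2" by (simp_all add: R1_def R2_def u_def v_def along_eq_D[of e1] along_eq_D[of e2])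
  define Ruu Ruv Rvv where "Ruu = hess p u u" and "Ruv = hess p u v" and "Rvv = hess p v v"
  have hess_vu: "hess p v u = Ruv" unfolding Ruv_def by (rule hess_commute[OF p])
  define A C where "A = h11 p" and "C = h12 p"
  define x1 x2 y1 y2 z1 z2 where "x1 = mink Ruu R1" and "x2 = mink Ruu R2" and "y1 = mink Ruv R1"
    and "y2 = mink Ruv R2" and "z1 = mink Rvv R1" and "z2 = mink Rvv R2"
  have RR: "mink R1 R1 = 1" "mink R2 R2 = 1" "mink R1 R2 = 0" "mink R2 R1 = 0"
    using orthonormal[OF p] orthonormal'[OF p] by (simp_all add: R)
  have normal: "A \<in> normal_plane r p" "C \<in> normal_plane r p"
    by (simp_all add: A_def C_def h11_def h12_def N_in_normal[OF p])
  then have AC: "mink A R1 = 0" "mink A R2 = 0" "mink C R1 = 0" "mink C R2 = 0"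
    "mink R1 A = 0" "mink R2 A = 0" "mink R1 C = 0" "mink R2 C = 0"
    by (simp_all add: normal_plane_iff R1_def R2_def mink_commute[of _ A] mink_commute[of _ C])
  have Ruu: "Ruu = x1 *\<^sub>R R1 + x2 *\<^sub>R R2 + A" and Ruv: "Ruv = y1 *\<^sub>R R1 + y2 *\<^sub>R R2 + C"
    by (simp_all add: A_def C_def h11_def h12_def N_eq'[OF p] R x1_def x2_def y1_def y2_def Ruu_def Ruv_def u_def v_def)
  have "- A = Rvv - z1 *\<^sub>R R1 - z2 *\<^sub>R R2"
    using maximal_trace[OF p max[OF p]] by (simp add: A_def N_eq'[OF p] R z1_def z2_def Rvv_def v_def)
  then have Rvv: "Rvv = z1 *\<^sub>R R1 + z2 *\<^sub>R R2 - A" by (simp add: algebra_simps)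
  have pull: "pull p (Ruu + Rvv) = (x1 + z1) *\<^sub>R u + (x2 + z2) *\<^sub>R v"
    by (simp add: pull_def R mink_linear x1_def x2_def z1_def z2_def u_def v_def)

  define P1 where "P1 = D u (D u (D u r)) p + D u (D v (D v r)) p"
  define P2 where "P2 = D v (D u (D u r)) p + D v (D v (D v r)) p"
  note third = maximal_third_derivative[OF p max, folded u_def v_def, folded R1_def R2_def Ruu_def Ruv_def Rvv_def,
      unfolded pull bilinear_simps[OF bilinear_hess[OF p]]]
  obtain k1 k2 where P1: "P1 = - (2 * y2) *\<^sub>R Ruu + (2 * (x2 + y1)) *\<^sub>R Ruv - (2 * x1) *\<^sub>R Rvv
         + (k1 *\<^sub>R R1 + k2 *\<^sub>R R2) + ((x1 + z1) *\<^sub>R Ruu + (x2 + z2) *\<^sub>R Ruv)"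
    using third[of u] unfolding P1_def
    by (auto simp: x1_def x2_def y1_def y2_def mink_commute[of R1] mink_commute[of R2] simp flip: Ruu_def Ruv_def)
  obtain l1 l2 where P2: "P2 = - (2 * z2) *\<^sub>R Ruu + (2 * (y2 + z1)) *\<^sub>R Ruv - (2 * y1) *\<^sub>R Rvv
         + (l1 *\<^sub>R R1 + l2 *\<^sub>R R2) + ((x1 + z1) *\<^sub>R Ruv + (x2 + z2) *\<^sub>R Rvv)"
    using third[of v] unfolding P2_def hess_vu
    by (auto simp: z1_def z2_def y1_def y2_def mink_commute[of R1] mink_commute[of R2] simp flip: Rvv_def)

  define f where "f q = det2 (e1 q) (e2 q) / det2 u v" for q
  define B where "B q = dual (D u r q) (D v r q)" for q
  have gauss_eq: "gauss q = f q *\<^sub>R B q" if "q \<in> U" for q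
    unfolding f_def B_def u_def v_def by (rule gauss_eq_coordinates[OF p that])
  have smooth: "smooth_on f U" "smooth_on B U"
    unfolding f_def B_def divide_inverse
    by (intro smooth_on_mult smooth_on_const smooth_det2 dual.smooth_on open_U smooth_Dr)+
  have diff: "f differentiable (at q)" "B differentiable (at q)" "D w f differentiable (at q)" "D w B differentiable (at q)"
    if "q \<in> U" for q w
    using smooth smooth_on_D smooth_on_differentiable that by blast+
  have f_p: "f p = 1" using oriented[OF p] by (simp add: f_def u_def v_def)
  have B_p: "B p = dual R1 R2" "gauss p = dual R1 R2"
    by (simp_all add: B_def R1_def R2_def gauss_eq[OF p] f_p)
  note sc = bounded_bilinear.along_prod[OF bounded_bilinear_scaleR]
  have DB: "D w B q = dual (D u r q) (hess q w v) + dual (hess q w u) (D v r q)" if "q \<in> U" for q w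
    unfolding B_def by (rule dual.along_prod[OF diff_Dr(1)[OF that] diff_Dr(1)[OF that]])
  have DDB: "D w (D w B) p = dual R1 (D w (D w (D v r)) p) + 2 *\<^sub>R dual (hess p w u) (hess p w v)
      + dual (D w (D w (D u r)) p) R2" for w
  proof -
    have "D w (D w B) p = D w (\<lambda>q. dual (D u r q) (hess q w v) + dual (hess q w u) (D v r q)) p"
      by (rule along_cong_open[OF open_U p DB])
    also have "\<dots> = D w (\<lambda>q. dual (D u r q) (hess q w v)) p + D w (\<lambda>q. dual (hess q w u) (D v r q)) p"
      by (intro along_add smooth_on_differentiable[OF dual.smooth_on[OF open_U] p] smooth_Dr)
    finally show ?thesis
      by (simp add: dual.along_prod diff_Dr[OF p] R1_def R2_def scaleR_2)
  qed
  have Dg: "D w gauss q = f q *\<^sub>R D w B q + D w f q *\<^sub>R B q" if "q \<in> U" for q w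
  proof -
    have "D w gauss q = D w (\<lambda>q. f q *\<^sub>R B q) q" by (rule along_cong_open[OF open_U that gauss_eq])
    then show ?thesis using sc[OF diff(1,2)[OF that]] by simp
  qed
  have DDg: "D w (D w gauss) p = D w (D w B) p + 2 *\<^sub>R D w f p *\<^sub>R D w B p + D w (D w f) p *\<^sub>R B p" for w
  proof -
    have "D w (D w gauss) p = D w (\<lambda>q. f q *\<^sub>R D w B q + D w f q *\<^sub>R B q) p"
      by (rule along_cong_open[OF open_U p Dg])
    also have "\<dots> = D w (\<lambda>q. f q *\<^sub>R D w B q) p + D w (\<lambda>q. D w f q *\<^sub>R B q) p"
      by (intro along_add smooth_on_differentiable[OF smooth_on_scaleR[OF open_U] p] smooth smooth_on_D)
    finally show ?thesis using sc[OF diff(1)[OF p] diff(4)[OF p]] sc[OF diff(3)[OF p] diff(2)[OF p]]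
      by (simp add: f_p vec_eq_iff algebra_simps)
  qed
  have Bu: "D u B p = dual R1 Ruv + dual Ruu R2" and Bv: "D v B p = dual R1 Rvv + dual Ruv R2"
    by (simp_all add: DB[OF p] R1_def R2_def hess_vu[symmetric]) (simp_all add: Ruu_def Ruv_def Rvv_def hess_vu)
  \<comment> \<open>\<open>D w gauss p\<close> has no component along \<open>gauss p\<close>, which
    determines the derivative of \<open>f\<close> without differentiating the frame.\<close>
  have "D w f p = - bivec_form (D w B p) (dual R1 R2)" for w
    using D_gauss_orthogonal[OF p, of w] by (simp add: Dg[OF p] f_p B_p bivec_form.add_left bivec_form.scaleR_left bivec_form_dual RR)
  then have fu: "D u f p = - (x1 + y2)" and fv: "D v f p = - (y1 + z2)"
    by (simp_all add: Bu Bv bivec_form.add_left bivec_form_dual RR x1_def y2_def y1_def z2_def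
        mink_commute[of R1 Ruv] mink_commute[of R1 Rvv])
  \<comment> \<open>The tangential parts of the second derivatives of \<open>r\<close> cancel
    against the derivative of \<open>f\<close>.\<close>
  have Dgu: "D u gauss p = dual R1 C + dual A R2" and Dgv: "D v gauss p = - dual R1 A + dual C R2"
    unfolding Dg[OF p] f_p B_p Bu Bv fu fv unfolding Ruu Ruv Rvv
    by (simp_all add: dual_linear algebra_simps)

  have lap: "laplacian r gauss p = (x1 + z1) *\<^sub>R D u gauss p + (x2 + z2) *\<^sub>R D v gauss p
      - (D u (D u gauss) p + D v (D v gauss) p)"
    using laplacian_eq[OF p smooth_gauss, folded u_def v_def, folded Ruu_def Rvv_def]
    by (simp add: pull D_linear[OF smooth_on_differentiable[OF smooth_gauss p]])
  have "D u (D u gauss) p + D v (D v gauss) p = dual P1 R2 + dual R1 P2 + 2 *\<^sub>R dual Ruu Ruv + 2 *\<^sub>R dual Ruv Rvv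
         + 2 *\<^sub>R (D u f p) *\<^sub>R (D u B p) + 2 *\<^sub>R (D v f p) *\<^sub>R D v B p
         + (D u (D u f) p + D v (D v f) p) *\<^sub>R dual R1 R2"
    unfolding DDg DDB P1_def P2_def third_derivative_commute[OF p, of u v] third_derivative_commute[OF p, of v u]
    by (simp add: hess_vu B_p dual_linear algebra_simps flip: Ruu_def Ruv_def Rvv_def)
  then have "\<exists>c. laplacian r gauss p = c *\<^sub>R dual R1 R2 - 4 *\<^sub>R dual A C"
    using gauss_laplacian_algebra[OF Ruu Ruv Rvv P1 P2 Bu Bv fu fv, of "D u (D u f) p + D v (D v f) p"]
    by (simp add: lap Dg[OF p] f_p B_p)
  then obtain c where c: "laplacian r gauss p = c *\<^sub>R dual R1 R2 - 4 *\<^sub>R dual A C" by blast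
  \<comment> \<open>\<open>c\<close> is read off from the fact that the Gauss map has constant length.\<close>
  have "c = bivec_form (laplacian r gauss p) (gauss p)"
    by (simp add: c B_p bivec_form.diff_left bivec_form.scaleR_left bivec_form_dual RR AC)
  also have "\<dots> = bivec_form (D u gauss p) (D u gauss p) + bivec_form (D v gauss p) (D v gauss p)"
    by (simp add: lap bivec_form.diff_left bivec_form.add_left bivec_form.scaleR_left
        D_gauss_orthogonal[OF p] DD_gauss_gauss[OF p])
  also have "\<dots> = 2 * (mink A A + mink C C)"
    by (simp add: Dgu Dgv bivec_form.add_left bivec_form.add_right bivec_form.diff_left bivec_form.diff_right
        bivec_form_dual RR AC)
  finally show ?thesis using c by (simp add: A_def C_def B_p)
qed

section \<open>The equations of Gauss and Ricci\<close>

lemma smooth_N: "smooth_on \<eta> U \<Longrightarrow> smooth_on (\<lambda>q. N q (\<eta> q)) U"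
proof -
  assume \<eta>: "smooth_on \<eta> U"
  have "smooth_on (\<lambda>q. \<eta> q - mink (\<eta> q) (t1 q) *\<^sub>R t1 q - mink (\<eta> q) (t2 q) *\<^sub>R t2 q) U"
    by (intro smooth_on_diff smooth_on_scaleR mink.smooth_on open_U \<eta> smooth_t)
  with smooth_on_cong[OF open_U, of "\<lambda>q. N q (\<eta> q)", OF N_eq'] show ?thesis by simp
qed

lemma smooth_pull: "smooth_on \<eta> U \<Longrightarrow> smooth_on (\<lambda>q. pull q (\<eta> q)) U"
  unfolding pull_def
  by (intro smooth_on_add smooth_on_scaleR mink.smooth_on open_U smooth_t smooth_e1 smooth_e2)

definition h :: "real^2 \<Rightarrow> real^2 \<Rightarrow> real^2 \<Rightarrow> real^4" where "h p x y = N p (hess p x y)"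

lemma bilinear_h: "p \<in> U \<Longrightarrow> bilinear (h p)"
  by (rule bilinearI) (simp_all add: h_def N_linear bilinear_simps[OF bilinear_hess])

lemma h_frame:
  assumes "p \<in> U" "mean_curv r p = 0"
  shows "h p (e1 p) (e1 p) = h11 p" "h p (e1 p) (e2 p) = h12 p" "h p (e2 p) (e1 p) = h12 p" "h p (e2 p) (e2 p) = - h11 p"
  using maximal_trace[OF assms] hess_commute[OF assms(1), of "e2 p" "e1 p"]
  by (simp_all add: h_def h11_def h12_def)

lemma h_expand:
  assumes "p \<in> U" "mean_curv r p = 0"
    and "x = a *\<^sub>R e1 p + b *\<^sub>R e2 p" "y = c *\<^sub>R e1 p + d *\<^sub>R e2 p"
  shows "h p x y = (a * c - b * d) *\<^sub>R h11 p + (a * d + b * c) *\<^sub>R h12 p"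
  unfolding assms(3,4)
  by (simp add: bilinear_simps[OF bilinear_h[OF assms(1)]] h_frame[OF assms(1,2)] algebra_simps)

lemma h11_h12_normal: "p \<in> U \<Longrightarrow> h11 p \<in> normal_plane r p" "p \<in> U \<Longrightarrow> h12 p \<in> normal_plane r p"
  by (simp_all add: h11_def h12_def N_in_normal)

text \<open>A vector and its tangential part have the same products with \<open>D a r\<close>.
  Differentiating this equality leaves the normal part against \<open>hess\<close>, so
  \<open>pull\<close> itself is never differentiated.\<close>

lemma D_tangential:
  assumes p: "p \<in> U" and \<eta>: "smooth_on \<eta> U"
  shows "mink (D c (\<lambda>q. D (pull q (\<eta> q)) r q) p) (D a r p)
    = mink (D c \<eta> p) (D a r p) + mink (N p (\<eta> p)) (hess p c a)"
proof -
  define \<tau> where "\<tau> q = D (pull q (\<eta> q)) r q" for q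
  have "\<tau> = along (\<lambda>q. pull q (\<eta> q)) r" by (simp add: \<tau>_def fun_eq_iff along_eq_D[of "\<lambda>q. pull q (\<eta> q)"])
  then have "smooth_on \<tau> U" using smooth_on_along[OF open_U smooth_r smooth_pull[OF \<eta>]] by simp
  then have diff: "\<tau> differentiable at p" "\<eta> differentiable at p"
    using smooth_on_differentiable p \<eta> by blast+
  have "D c (\<lambda>q. mink (\<tau> q) (D a r q)) p = D c (\<lambda>q. mink (\<eta> q) (D a r q)) p"
    by (rule along_cong_open[OF open_U p]) (simp add: \<tau>_def mink_D_pull)
  then have "mink (\<tau> p) (hess p c a) + mink (D c \<tau> p) (D a r p) = mink (\<eta> p) (hess p c a) + mink (D c \<eta> p) (D a r p)"
    by (simp add: mink.along_prod diff diff_Dr[OF p])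
  moreover have "\<tau> p = \<eta> p - N p (\<eta> p)" by (simp add: N_eq[OF p] \<tau>_def)
  ultimately have "mink (D c \<tau> p) (D a r p) = mink (D c \<eta> p) (D a r p) + mink (N p (\<eta> p)) (hess p c a)"
    by (simp add: mink_linear)
  then show ?thesis by (simp add: \<tau>_def[abs_def])
qed

text \<open>Constant fields have zero bracket and the ambient third derivatives cancel by symmetry;
  the correction terms from \<open>D_tangential\<close> remain.\<close>

lemma gauss_equation:
  assumes p: "p \<in> U"
  shows "metric r (curvature r (\<lambda>_. a) (\<lambda>_. b) (\<lambda>_. b)) (\<lambda>_. a) p
    = mink (h p a a) (h p b b) - mink (h p a b) (h p a b)"
proof -
  have nabla2: "along (nabla r (\<lambda>_. c) (\<lambda>_. b)) r q = D (pull q (hess q c b)) r q" if "q \<in> U" for c q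
    by (subst along_eq_D) (simp add: nabla_eq[OF that])
  have main: "mink (D (nabla r (\<lambda>_. d) (nabla r (\<lambda>_. c) (\<lambda>_. b)) p) r p) (D a r p)
      = mink (D d (D c (D b r)) p) (D a r p) + mink (N p (hess p c b)) (hess p d a)" for c d
  proof -
    have "D d (along (nabla r (\<lambda>_. c) (\<lambda>_. b)) r) p = D d (\<lambda>q. D (pull q (hess q c b)) r q) p"
      by (rule along_cong_open[OF open_U p nabla2])
    then show ?thesis
      by (simp add: nabla_eq[OF p] mink_D_pull[OF p] D_tangential[OF p smooth_Dr(2)])
  qed
  have zero: "nabla r (lie_bracket (\<lambda>_. a) (\<lambda>_. b)) (\<lambda>_. b) p = 0"
    using D_linear(4)[OF diff_Dr(1)[OF p]] by (simp add: nabla_eq[OF p] lie_bracket_def pull_linear)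
  have "metric r (curvature r (\<lambda>_. a) (\<lambda>_. b) (\<lambda>_. b)) (\<lambda>_. a) p
     = mink (D (curvature r (\<lambda>_. a) (\<lambda>_. b) (\<lambda>_. b) p) r p) (D a r p)"
    by (simp add: metric_def push_eq_along along_eq_D[of "curvature _ _ _ _"])
  also have "\<dots> = mink (N p (hess p b b)) (hess p a a) - mink (N p (hess p a b)) (hess p b a)"
    unfolding curvature_def zero
    by (simp add: Dr_linear[OF p] mink.diff_left main D_commute[OF open_U smooth_Dr(1) p, of a b])
  finally show ?thesis
    unfolding h_def hess_commute[OF p, of b a] mink_N_N[OF p] mink_commute[of "N p (hess p b b)"]
      mink_commute[of "N p (hess p a b)"] .
qed

text \<open>Passing from coordinate fields to the frame multiplies numerator and denominator by the
  same squared determinant; the sign comes from \<open>h p (e2 p) (e2 p) = - h11 p\<close>.\<close>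

lemma gauss_curv_eq:
  assumes p: "p \<in> U" and max: "mean_curv r p = 0"
  shows "gauss_curv r p = - (mink (h11 p) (h11 p) + mink (h12 p) (h12 p))"
proof -
  define x y :: "real^2" where "x = axis 1 1" and "y = axis 2 1"
  define a b c d where "a = mink (D x r p) (t1 p)" and "b = mink (D x r p) (t2 p)"
    and "c = mink (D y r p) (t1 p)" and "d = mink (D y r p) (t2 p)"
  have x: "x = a *\<^sub>R e1 p + b *\<^sub>R e2 p" and y: "y = c *\<^sub>R e1 p + d *\<^sub>R e2 p"
    unfolding a_def b_def c_def d_def
    by (rule pull_D[OF p, unfolded pull_def, symmetric])+
  have "det2 x y = (a * d - b * c) * det2 (e1 p) (e2 p)"
    unfolding x y by (simp add: det2_def algebra_simps)
  moreover have "det2 x y = 1" by (simp add: det2_def x_def y_def axis_nth_if)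
  ultimately have ne: "a * d - b * c \<noteq> 0" by auto
  have Dxy: "D x r p = a *\<^sub>R t1 p + b *\<^sub>R t2 p" "D y r p = c *\<^sub>R t1 p + d *\<^sub>R t2 p"
    unfolding a_def b_def c_def d_def
    by (rule D_pull[OF p, of "D _ r p", unfolded pull_D[OF p]])+
  have "mink (D x r p) (D x r p) * mink (D y r p) (D y r p) - (mink (D x r p) (D y r p))\<^sup>2 = (a * d - b * c)\<^sup>2"
    unfolding Dxy by (simp add: mink_linear orthonormal[OF p] orthonormal'[OF p] power2_eq_square algebra_simps)
  moreover have "mink (h p x x) (h p y y) - mink (h p x y) (h p x y)
      = (a * d - b * c)\<^sup>2 * - (mink (h11 p) (h11 p) + mink (h12 p) (h12 p))"
    unfolding h_expand[OF p max x x] h_expand[OF p max y y] h_expand[OF p max x y]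
    by (simp add: mink_linear mink_commute[of "h12 p" "h11 p"] power2_eq_square algebra_simps)
  ultimately have "gauss_curv r p = (a * d - b * c)\<^sup>2 * - (mink (h11 p) (h11 p) + mink (h12 p) (h12 p)) / (a * d - b * c)\<^sup>2"
    unfolding gauss_curv_def Let_def gauss_equation[OF p]
    by (simp add: metric_def push_eq_along x_def y_def)
  with ne show ?thesis by simp
qed

section \<open>The Ricci equation and flatness of the normal bundle\<close>

lemma normal_conn_normal_conn:
  assumes p: "p \<in> U" and smooth: "smooth_on X U" "smooth_on Y U" "smooth_on \<xi> U"
  shows "normal_conn r X (normal_conn r Y \<xi>) p
    = N p (along X (along Y \<xi>) p) - h p (X p) (pull p (along Y \<xi> p))"
proof -
  define Z where "Z q = pull q (along Y \<xi> q)" for q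
  have Y\<xi>: "smooth_on (along Y \<xi>) U" by (rule smooth_on_along[OF open_U smooth(3,2)])
  have Z: "smooth_on Z U" unfolding Z_def by (rule smooth_pull[OF Y\<xi>])
  \<comment> \<open>Written as \<open>along Z r\<close>, the subtracted tangential part has as
    derivative a tangent vector plus a value of \<open>hess\<close>.\<close>
  have "normal_conn r Y \<xi> q = along Y \<xi> q - along Z r q" if "q \<in> U" for q
    by (simp add: normal_conn_def N_eq[OF that] along_eq_D[of Z] Z_def)
  then have "along X (normal_conn r Y \<xi>) p = along X (\<lambda>q. along Y \<xi> q - along Z r q) p"
    by (rule along_cong_open[OF open_U p])
  also have "\<dots> = along X (along Y \<xi>) p - along X (along Z r) p"
    by (intro along_diff smooth_on_differentiable[OF _ p] Y\<xi> smooth_on_along[OF open_U smooth_r Z])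
  also have "along X (along Z r) p = D (along X Z p) r p + hess p (X p) (Z p)"
    by (rule along_along_r[OF p smooth_on_differentiable[OF Z p]])
  finally have "normal_conn r X (normal_conn r Y \<xi>) p
     = N p (along X (along Y \<xi>) p - (D (along X Z p) r p + hess p (X p) (Z p)))"
    unfolding normal_conn_def[of r X] by (rule arg_cong)
  then show ?thesis by (simp add: N_linear[OF p] N_D[OF p] h_def Z_def)
qed

text \<open>The Weingarten relation, from differentiating the vanishing product of
  \<open>\<xi>\<close> with \<open>D w r\<close>.\<close>

lemma mink_along_normal:
  assumes p: "p \<in> U" and "smooth_on \<xi> U" "\<And>q. q \<in> U \<Longrightarrow> \<xi> q \<in> normal_plane r q"
  shows "mink (along Y \<xi> p) (D w r p) = - mink (\<xi> p) (h p (Y p) w)"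
proof -
  have "along Y (\<lambda>q. mink (\<xi> q) (D w r q)) p = along Y (\<lambda>q. 0) p"
    by (rule along_cong_open[OF open_U p]) (use assms(3) normal_plane_iff in auto)
  then have "mink (\<xi> p) (along Y (D w r) p) + mink (along Y \<xi> p) (D w r p) = 0"
    by (simp add: mink.along_prod smooth_on_differentiable[OF assms(2) p] diff_Dr[OF p])
  moreover have "mink (\<xi> p) (h p (Y p) w) = mink (\<xi> p) (along Y (D w r) p)"
    using mink_N_normal[OF p assms(3)[OF p], of "hess p (Y p) w"]
    by (simp add: h_def mink_commute[of "\<xi> p"] along_eq_D[of Y])
  ultimately show ?thesis by simp
qed

lemma ricci_equation:
  assumes p: "p \<in> U" and max: "mean_curv r p = 0"
    and smooth: "smooth_on X U" "smooth_on Y U" "smooth_on \<xi> U"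
    and normal: "\<And>q. q \<in> U \<Longrightarrow> \<xi> q \<in> normal_plane r q"
  shows "normal_curvature r X Y \<xi> p = (2 * det2 (X p) (Y p) / det2 (e1 p) (e2 p)) *\<^sub>R
    (mink (\<xi> p) (h12 p) *\<^sub>R h11 p - mink (\<xi> p) (h11 p) *\<^sub>R h12 p)"
proof -
  have diff: "X differentiable at p" "Y differentiable at p" "\<xi> differentiable at p"
    using smooth smooth_on_differentiable p by blast+
  \<comment> \<open>The ambient connection is flat: its curvature terms cancel and only the second
    fundamental form contributes.\<close>
  have "along X (along Y \<xi>) p - along Y (along X \<xi>) p = along (lie_bracket X Y) \<xi> p"
    using along_along[OF open_U smooth(3) p diff(2), of X] along_along[OF open_U smooth(3) p diff(1), of Y]
      D_commute[OF open_U smooth(3) p, of "X p" "Y p"]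
    by (subst along_eq_D[of "lie_bracket X Y"]) (simp add: lie_bracket_def D_linear[OF diff(3)])
  then have "N p (along X (along Y \<xi>) p) - N p (along Y (along X \<xi>) p) = normal_conn r (lie_bracket X Y) \<xi> p"
    by (simp add: normal_conn_def flip: N_linear(2)[OF p])
  then have R: "normal_curvature r X Y \<xi> p = h p (Y p) (pull p (along X \<xi> p)) - h p (X p) (pull p (along Y \<xi> p))"
    unfolding normal_curvature_def
      normal_conn_normal_conn[OF p smooth(1,2,3)] normal_conn_normal_conn[OF p smooth(2,1,3)]
    by (simp add: algebra_simps)
  define a b c d where "a = mink (D (X p) r p) (t1 p)" and "b = mink (D (X p) r p) (t2 p)"
    and "c = mink (D (Y p) r p) (t1 p)" and "d = mink (D (Y p) r p) (t2 p)"
  have X: "X p = a *\<^sub>R e1 p + b *\<^sub>R e2 p" and Y: "Y p = c *\<^sub>R e1 p + d *\<^sub>R e2 p"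
    unfolding a_def b_def c_def d_def
    by (rule pull_D[OF p, unfolded pull_def, symmetric])+
  have det: "det2 (X p) (Y p) / det2 (e1 p) (e2 p) = a * d - b * c"
    using oriented[OF p] unfolding X Y by (simp add: field_simps) (simp add: det2_def algebra_simps)
  have e: "e1 p = 1 *\<^sub>R e1 p + 0 *\<^sub>R e2 p" "e2 p = 0 *\<^sub>R e1 p + 1 *\<^sub>R e2 p" by simp_all
  have pull: "pull p (along W \<xi> p) = - mink (\<xi> p) (h p (W p) (e1 p)) *\<^sub>R e1 p + - mink (\<xi> p) (h p (W p) (e2 p)) *\<^sub>R e2 p" for W
    using mink_along_normal[OF p smooth(3) normal, of W]
    by (simp add: pull_def along_eq_D[of e1] along_eq_D[of e2])
  show ?thesis
    unfolding R h_expand[OF p max Y pull] h_expand[OF p max X pull]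
    unfolding h_expand[OF p max X e(1)] h_expand[OF p max X e(2)] h_expand[OF p max Y e(1)] h_expand[OF p max Y e(2)]
    by (simp add: det mink_linear vec_eq_iff flip: times_divide_eq_right) (simp add: algebra_simps)
qed

text \<open>Pairing with \<open>dual y \<xi>\<close> turns the bivector into the vector on the
  right, tested against \<open>y\<close>. Conversely, if the bivector were nonzero, the right side
  would make \<open>h11 p\<close> orthogonal to all normal vectors, hence zero by
  nondegeneracy.\<close>

lemma dual_h_eq_0_iff:
  assumes p: "p \<in> U"
  shows "dual (h11 p) (h12 p) = 0 \<longleftrightarrow>
    (\<forall>\<xi>\<in>normal_plane r p. mink \<xi> (h12 p) *\<^sub>R h11 p - mink \<xi> (h11 p) *\<^sub>R h12 p = 0)" (is "?L \<longleftrightarrow> ?R")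
proof
  assume ?L
  show ?R
  proof
    fix \<xi>
    have "mink (mink \<xi> (h12 p) *\<^sub>R h11 p - mink \<xi> (h11 p) *\<^sub>R h12 p) y = 0" for y
    proof -
      have "bivec_form (dual (h11 p) (h12 p)) (dual y \<xi>) = 0" using \<open>?L\<close> by (simp add: bivec_form.zero_left)
      then show ?thesis by (simp add: bivec_form_dual mink_linear mink_commute algebra_simps)
    qed
    then show "mink \<xi> (h12 p) *\<^sub>R h11 p - mink \<xi> (h11 p) *\<^sub>R h12 p = 0" by (rule mink_nondegenerate)
  qed
next
  assume R: ?R
  have dep: "dual (mink \<xi> (h12 p) *\<^sub>R h11 p) (h12 p) = 0" "dual (h11 p) (mink \<xi> (h11 p) *\<^sub>R h12 p) = 0"
    if "\<xi> \<in> normal_plane r p" for \<xi>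
  proof -
    have *: "mink \<xi> (h12 p) *\<^sub>R h11 p = mink \<xi> (h11 p) *\<^sub>R h12 p" using R that by simp
    show "dual (mink \<xi> (h12 p) *\<^sub>R h11 p) (h12 p) = 0" unfolding * by (simp add: dual_linear)
    show "dual (h11 p) (mink \<xi> (h11 p) *\<^sub>R h12 p) = 0" unfolding *[symmetric] by (simp add: dual_linear)
  qed
  show ?L
  proof (rule ccontr)
    assume ne: "dual (h11 p) (h12 p) \<noteq> 0"
    have "mink (h11 p) y = 0" for y
    proof -
      have "mink (N p y) (h11 p) = 0"
        using dep(2)[OF N_in_normal[OF p, of y]] ne by (simp add: dual_linear)
      then show ?thesis using mink_N_normal[OF p h11_h12_normal(1)[OF p]] by (simp add: mink_commute)
    qed
    then have "h11 p = 0" by (rule mink_nondegenerate)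
    with ne show False by (simp add: dual_linear)
  qed
qed

text \<open>The two summands of the Laplacian are orthogonal, since \<open>dual (h11 p) (h12 p)\<close> is the dual of a
  normal bivector, hence they vanish separately.\<close>

lemma laplacian_gauss_eq_0_iff:
  assumes p: "p \<in> U" and max: "\<And>q. q \<in> U \<Longrightarrow> mean_curv r q = 0"
  shows "laplacian r gauss p = 0 \<longleftrightarrow> gauss_curv r p = 0 \<and> dual (h11 p) (h12 p) = 0"
proof -
  define c where "c = mink (h11 p) (h11 p) + mink (h12 p) (h12 p)"
  have lap: "laplacian r gauss p = (2 * c) *\<^sub>R gauss p - 4 *\<^sub>R dual (h11 p) (h12 p)"
    unfolding c_def by (rule laplacian_gauss[OF p max])
  have K: "gauss_curv r p = - c"
    unfolding c_def by (rule gauss_curv_eq[OF p max[OF p]])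
  have "bivec_form (dual (h11 p) (h12 p)) (gauss p) = 0"
    using h11_h12_normal[OF p]
    by (simp add: gauss_def bivec_form_dual normal_plane_iff along_eq_D[of e1] along_eq_D[of e2])
  then have "bivec_form (laplacian r gauss p) (gauss p) = 2 * c"
    unfolding lap by (simp add: bivec_form.diff_left bivec_form.scaleR_left bivec_form_gauss[OF p])
  then have "c = 0" if "laplacian r gauss p = 0"
    using that by (simp add: bivec_form.zero_left)
  then show ?thesis using lap K by auto
qed

end

section \<open>Charts of the abstract surface\<close>

text \<open>Gram-Schmidt on the coordinate fields with denominators cleared:
  \<open>E q *\<^sub>R b - F q *\<^sub>R a\<close> is orthogonal to \<open>a\<close> in the induced
  metric and has squared length \<open>E q * \<Delta> q\<close>.\<close>

lemma gram_schmidt_frame: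
  assumes U: "open U" and r: "smooth_on r U"
    and inj: "\<And>p. p \<in> U \<Longrightarrow> inj (frechet_derivative r (at p))"
    and space_like: "\<And>p v. p \<in> U \<Longrightarrow> v \<in> tangent_plane r p \<Longrightarrow> v \<noteq> 0 \<Longrightarrow> mink v v > 0"
  obtains e1 e2 where "framed_surface r U e1 e2"
proof -
  define a b :: "real^2" where "a = axis 1 1" and "b = axis 2 1"
  define E where "E q = mink (D a r q) (D a r q)" for q
  define F where "F q = mink (D a r q) (D b r q)" for q
  define G where "G q = mink (D b r q) (D b r q)" for q
  define \<Delta> where "\<Delta> q = E q * G q - F q * F q" for q
  note lin = D_linear[OF smooth_on_differentiable[OF r]]
  have pos: "mink (D w r q) (D w r q) > 0" if "q \<in> U" "w \<noteq> 0" for q w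
  proof (rule space_like[OF that(1)])
    show "D w r q \<in> tangent_plane r q" by (simp add: tangent_plane_def along_def)
    show "D w r q \<noteq> 0"
      using inj_onD[OF inj[OF that(1)], of w 0] lin(4)[OF that(1)] that(2) by (auto simp: along_def)
  qed
  have E: "E q > 0" if "q \<in> U" for q
    unfolding E_def by (rule pos[OF that]) (simp add: a_def axis_eq_0_iff)
  have \<Delta>: "E q * \<Delta> q > 0" if "q \<in> U" for q
  proof -
    have "(E q *\<^sub>R b - F q *\<^sub>R a)$2 = E q" by (simp add: a_def b_def axis_nth_if)
    then have "E q *\<^sub>R b - F q *\<^sub>R a \<noteq> 0" using E[OF that] by (metis less_irrefl zero_index)
    from pos[OF that this] show ?thesis
      by (simp add: lin[OF that] mink_linear \<Delta>_def mink_commute[of "D b r q" "D a r q"] algebra_simps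
          flip: E_def F_def G_def)
  qed
  define e1 where "e1 q = inverse (sqrt (E q)) *\<^sub>R a" for q
  define e2 where "e2 q = inverse (sqrt (E q * \<Delta> q)) *\<^sub>R (E q *\<^sub>R b - F q *\<^sub>R a)" for q
  have smooth_EFG: "smooth_on E U" "smooth_on F U" "smooth_on G U"
    unfolding E_def F_def G_def by (intro mink.smooth_on U smooth_on_D r)+
  then have smooth_\<Delta>: "smooth_on (\<lambda>q. E q * \<Delta> q) U"
    unfolding \<Delta>_def by (intro smooth_on_mult smooth_on_diff U)
  have t1: "along e1 r q = inverse (sqrt (E q)) *\<^sub>R D a r q" if "q \<in> U" for q
    by (simp add: along_eq_D[of e1] e1_def lin[OF that])
  have t2: "along e2 r q = inverse (sqrt (E q * \<Delta> q)) *\<^sub>R (E q *\<^sub>R D b r q - F q *\<^sub>R D a r q)" if "q \<in> U" for q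
    by (simp add: along_eq_D[of e2] e2_def lin[OF that])
  have "framed_surface r U e1 e2"
  proof
    show "open U" "smooth_on r U" by fact+
    show "smooth_on e1 U"
      unfolding e1_def
      by (intro smooth_on_scaleR smooth_on_inverse smooth_on_sqrt smooth_on_const U smooth_EFG E)
        (use E in force)
    show "smooth_on e2 U"
      unfolding e2_def
      by (intro smooth_on_scaleR smooth_on_inverse smooth_on_sqrt smooth_on_const smooth_on_diff U smooth_EFG smooth_\<Delta> \<Delta>)
        (use \<Delta> in force)
    fix q assume q: "q \<in> U"
    have s: "inverse (sqrt c) * inverse (sqrt c) * c = 1" if "c > 0" for c
      using that by (simp flip: inverse_mult_distrib)
    show "mink (along e1 r q) (along e1 r q) = 1"
      using s[OF E[OF q]] by (simp add: t1[OF q] mink_linear mult.assoc flip: E_def)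
    have "mink (E q *\<^sub>R D b r q - F q *\<^sub>R D a r q) (E q *\<^sub>R D b r q - F q *\<^sub>R D a r q) = E q * \<Delta> q"
      by (simp add: mink_linear \<Delta>_def mink_commute[of "D b r q" "D a r q"] algebra_simps
          flip: E_def F_def G_def)
    then show "mink (along e2 r q) (along e2 r q) = 1"
      using s[OF \<Delta>[OF q]] by (simp only: t2[OF q] mink.scaleR_left mink.scaleR_right real_scaleR_def mult.assoc)
    show "mink (along e1 r q) (along e2 r q) = 0"
      by (simp add: t1[OF q] t2[OF q] mink_linear flip: E_def F_def)
    show "det2 (e1 q) (e2 q) > 0"
      using E[OF q] \<Delta>[OF q] by (simp add: det2_def e1_def e2_def a_def b_def axis_nth_if)
  qed
  then show ?thesis by (rule that)
qed

lemma laplacian_cong_open: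
  assumes "open U" "p \<in> U" "\<And>q. q \<in> U \<Longrightarrow> F q = G q"
  shows "laplacian r F p = laplacian r G p"
proof -
  have "along X F p = along X G p" "along X (along X F) p = along X (along X G) p" for X
    using along_cong_open[OF assms(1), of _ F G] assms(3) along_cong_open[OF assms(1,2), of "along X F" "along X G"]
      assms(2) by blast+
  then show ?thesis by (simp add: laplacian_def)
qed

context framed_surface
begin

text \<open>Two positively oriented orthonormal bases of the tangent plane give the same bivector:
  the factor \<open>k\<close> is positive by orientation and has square 1 by length.\<close>

lemma wedge_eq_gauss:
  assumes p: "p \<in> U" and e: "adapted_frame r p e"
  shows "e 3 \<and>\<^sub>E e 4 = gauss p"
proof -
  obtain w :: "real^2^2" where w: "det w > 0" "e 1 = D (w$1) r p" "e 2 = D (w$2) r p"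
    using e by (auto simp: adapted_frame_def along_def)
  have orth: "\<And>i j. i \<noteq> j \<Longrightarrow> mink (e i) (e j) = 0" and unit: "\<And>i. \<bar>mink (e i) (e i)\<bar> = 1"
    and det: "det (\<chi> i. e i) > 0"
    using e by (auto simp: adapted_frame_def)
  have "mink (D z r p) (D z r p) \<ge> 0" for z
  proof -
    have "D z r p = mink (D z r p) (t1 p) *\<^sub>R t1 p + mink (D z r p) (t2 p) *\<^sub>R t2 p"
      using D_pull[OF p, of "D z r p", unfolded pull_D[OF p]] .
    then obtain a b where "D z r p = a *\<^sub>R t1 p + b *\<^sub>R t2 p" by blast
    then show ?thesis by (simp add: mink_linear orthonormal[OF p] orthonormal'[OF p])
  qed
  then have pos: "mink (e 1) (e 1) = 1" "mink (e 2) (e 2) = 1"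
    using unit[of 1] unit[of 2] w(2,3) by (metis abs_of_nonneg)+
  have wedge: "e 3 \<and>\<^sub>E e 4 = dual (e 1) (e 2)"
    by (rule wedge_eq_dual[OF orth unit pos det])
  define k where "k = det2 (w$1) (w$2) / det2 (e1 p) (e2 p)"
  have "k > 0" using w(1) oriented[OF p] by (simp add: k_def det_2 det2_def)
  have "det2 (e1 p) (e2 p) *\<^sub>R dual (e 1) (e 2) = det2 (w$1) (w$2) *\<^sub>R gauss p"
    using dual_linear_image[OF linear_D[OF diff_r[OF p]], of "e1 p" "e2 p" "w$1" "w$2"]
    by (simp add: w gauss_def along_eq_D[of e1] along_eq_D[of e2])
  from arg_cong[OF this, of "\<lambda>z. (1 / det2 (e1 p) (e2 p)) *\<^sub>R z"] oriented[OF p]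
  have dual: "dual (e 1) (e 2) = k *\<^sub>R gauss p" by (simp add: k_def)
  have "bivec_form (dual (e 1) (e 2)) (dual (e 1) (e 2)) = 1"
    by (simp add: bivec_form_dual pos orth)
  then have "k * k = 1"
    by (simp add: dual bivec_form.scaleR_left bivec_form.scaleR_right bivec_form_gauss[OF p])
  then have "k = 1" using \<open>k > 0\<close> by (simp add: square_eq_1_iff)
  then show ?thesis by (simp add: wedge dual)
qed

lemma adapted_frame_exists:
  assumes p: "p \<in> U"
  obtains e where "adapted_frame r p e"
proof -
  obtain e where e: "e 1 = t1 p" "e 2 = t2 p" "\<And>i j. i \<noteq> j \<Longrightarrow> mink (e i) (e j) = 0"
    "\<And>i. \<bar>mink (e i) (e i)\<bar> = 1" "det (\<chi> i. e i) > 0"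
    using orthonormal_completion[OF orthonormal[OF p]] by blast
  define w :: "real^2^2" where "w = (\<chi> i. if i = 1 then e1 p else e2 p)"
  have "n \<in> normal_plane r p" if "mink n (t1 p) = 0" "mink n (t2 p) = 0" for n
    unfolding normal_plane_iff
  proof
    fix z
    have "mink n (D (pull p (D z r p)) r p) = 0" by (simp add: D_pull[OF p] mink_linear that)
    then show "mink n (D z r p) = 0" by (simp add: pull_D[OF p])
  qed
  then have "e 3 \<in> normal_plane r p" "e 4 \<in> normal_plane r p"
    using e(3)[of 3 1] e(3)[of 3 2] e(3)[of 4 1] e(3)[of 4 2] e(1,2) by auto
  moreover have "det w > 0" "e 1 = frechet_derivative r (at p) (w$1)" "e 2 = frechet_derivative r (at p) (w$2)"
    using oriented[OF p] e(1,2) by (simp_all add: w_def det_2 det2_def along_def)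
  ultimately have "adapted_frame r p e" using e(3-5) by (auto simp: adapted_frame_def)
  then show ?thesis by (rule that)
qed

lemma normal_curvature_vanishes_iff:
  assumes max: "\<And>q. q \<in> U \<Longrightarrow> mean_curv r q = 0"
  shows "(\<forall>V X Y \<xi>. open V \<and> V \<subseteq> U \<and> smooth_on X V \<and> smooth_on Y V \<and> smooth_on \<xi> V \<and>
        (\<forall>q\<in>V. \<xi> q \<in> normal_plane r q) \<longrightarrow> (\<forall>p\<in>V. normal_curvature r X Y \<xi> p = 0))
    \<longleftrightarrow> (\<forall>p\<in>U. dual (h11 p) (h12 p) = 0)" (is "?L \<longleftrightarrow> ?R")
proof
  assume L: ?L
  show ?R
  proof
    fix p assume p: "p \<in> U"
    show "dual (h11 p) (h12 p) = 0"
      unfolding dual_h_eq_0_iff[OF p]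
    proof
      fix n assume n: "n \<in> normal_plane r p"
      \<comment> \<open>Projecting the constant vector \<open>n\<close> extends it to a smooth
        normal field with value \<open>n\<close> at \<open>p\<close>.\<close>
      define \<xi> where "\<xi> q = N q n" for q
      have \<xi>: "smooth_on \<xi> U" "\<And>q. q \<in> U \<Longrightarrow> \<xi> q \<in> normal_plane r q"
        unfolding \<xi>_def by (rule smooth_N[OF smooth_on_const]) (rule N_in_normal)
      have "normal_curvature r e1 e2 \<xi> p = 0"
        using spec[OF spec[OF spec[OF spec[OF L, of U], of e1], of e2], of \<xi>] open_U smooth_e1 smooth_e2 \<xi> p
        by simp
      moreover have "\<xi> p = n" by (simp add: \<xi>_def N_normal[OF p n])
      ultimately show "mink n (h12 p) *\<^sub>R h11 p - mink n (h11 p) *\<^sub>R h12 p = 0"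
        using ricci_equation[OF p max[OF p] smooth_e1 smooth_e2 \<xi>] oriented[OF p] by simp
    qed
  qed
next
  assume R: ?R
  show ?L
  proof (intro allI impI ballI, elim conjE)
    fix V p and X Y :: "real^2 \<Rightarrow> real^2" and \<xi> :: "real^2 \<Rightarrow> real^4"
    assume V: "open V" "V \<subseteq> U" and smooth: "smooth_on X V" "smooth_on Y V" "smooth_on \<xi> V"
      and normal: "\<forall>q\<in>V. \<xi> q \<in> normal_plane r q" and p: "p \<in> V"
    \<comment> \<open>Fields are given only on \<open>V\<close>, so the frame is restricted;
      \<open>h11\<close> and \<open>h12\<close> depend on \<open>r\<close>, \<open>e1\<close>,
      \<open>e2\<close> alone and do not change.\<close>
    interpret V: framed_surface r V e1 e2
    proof
      show "open V" by (rule V(1))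
      show "smooth_on r V" "smooth_on e1 V" "smooth_on e2 V"
        by (rule smooth_on_subset[OF smooth_r V(2)] smooth_on_subset[OF smooth_e1 V(2)]
            smooth_on_subset[OF smooth_e2 V(2)])+
    qed (rule orthonormal oriented, rule subsetD[OF V(2)], assumption)+
    have "p \<in> U" using p V(2) by blast
    then have "mink (\<xi> p) (h12 p) *\<^sub>R h11 p - mink (\<xi> p) (h11 p) *\<^sub>R h12 p = 0"
      using R dual_h_eq_0_iff[OF \<open>p \<in> U\<close>] bspec[OF normal p] by blast
    then show "normal_curvature r X Y \<xi> p = 0"
      using V.ricci_equation[OF p max[OF \<open>p \<in> U\<close>] smooth] normal by simp
  qed
qed

end

section \<open>Independence of the Gauss map of the chart\<close>

lemma chart_derivative:
  assumes A: "oriented_surface A" "immersion A x"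
    and charts: "(U, \<phi>) \<in> A" "(V, \<psi>) \<in> A" and pq: "p \<in> U" "q \<in> V" "\<phi> p = \<psi> q"
  obtains T where "linear T" "det (matrix T) > 0"
    "frechet_derivative (x \<circ> \<phi>) (at p) = frechet_derivative (x \<circ> \<psi>) (at q) \<circ> T"
proof -
  define W where "W = U \<inter> \<phi> -` (\<psi> ` V)"
  define \<tau> where "\<tau> = inv_into V \<psi> \<circ> \<phi>"
  have 1: "open U" "homeomorphism U (\<phi> ` U) \<phi> (inv_into U \<phi>)" "open (\<psi> ` V)" "homeomorphism V (\<psi> ` V) \<psi> (inv_into V \<psi>)"
    using A(1) charts unfolding oriented_surface_def by blast+
  have \<tau>: "smooth_on \<tau> W" "\<And>z. z \<in> W \<Longrightarrow> det (matrix (frechet_derivative \<tau> (at z))) > 0"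
    using A(1) charts unfolding oriented_surface_def W_def \<tau>_def Let_def by blast+
  have "open W"
    unfolding W_def Int_commute[of U]
    by (rule continuous_on_open_vimage[OF 1(1), THEN iffD1, rule_format, OF _ 1(3)])
      (rule homeomorphism_cont1[OF 1(2)])
  have "p \<in> W" using pq by (auto simp: W_def)
  have "\<tau> p = q" using homeomorphism_apply1[OF 1(4) pq(2)] pq(3) by (simp add: \<tau>_def)
  have d\<tau>: "\<tau> differentiable (at p)" by (rule smooth_on_differentiable[OF \<tau>(1) \<open>p \<in> W\<close>])
  have d\<psi>: "(x \<circ> \<psi>) differentiable (at (\<tau> p))"
    using A(2) charts(2) pq(2) smooth_on_differentiable unfolding immersion_def \<open>\<tau> p = q\<close> by blast
  have eq: "(x \<circ> \<phi>) z = ((x \<circ> \<psi>) \<circ> \<tau>) z" if "z \<in> W" for z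
    using that by (auto simp: W_def \<tau>_def f_inv_into_f)
  have "frechet_derivative (x \<circ> \<phi>) (at p) = frechet_derivative ((x \<circ> \<psi>) \<circ> \<tau>) (at p)"
  proof
    fix v show "frechet_derivative (x \<circ> \<phi>) (at p) v = frechet_derivative ((x \<circ> \<psi>) \<circ> \<tau>) (at p) v"
      using along_cong_open[OF \<open>open W\<close> \<open>p \<in> W\<close>, of "x \<circ> \<phi>" "(x \<circ> \<psi>) \<circ> \<tau>" "\<lambda>_. v", OF eq]
      unfolding along_def .
  qed
  also have "\<dots> = frechet_derivative (x \<circ> \<psi>) (at q) \<circ> frechet_derivative \<tau> (at p)"
    unfolding \<open>\<tau> p = q\<close>[symmetric] by (rule frechet_derivative_compose[OF d\<tau> d\<psi>])
  finally show ?thesis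
    by (intro that[of "frechet_derivative \<tau> (at p)"]) (use \<tau>(2)[OF \<open>p \<in> W\<close>] linear_frechet_derivative[OF d\<tau>] in auto)
qed

lemma tangent_plane_chart:
  assumes A: "oriented_surface A" "immersion A x"
    and charts: "(U, \<phi>) \<in> A" "(V, \<psi>) \<in> A" and pq: "p \<in> U" "q \<in> V" "\<phi> p = \<psi> q"
  shows "tangent_plane (x \<circ> \<phi>) p = tangent_plane (x \<circ> \<psi>) q"
proof -
  have "tangent_plane (x \<circ> \<phi>) p \<subseteq> tangent_plane (x \<circ> \<psi>) q"
    if c: "(U, \<phi>) \<in> A" "(V, \<psi>) \<in> A" "p \<in> U" "q \<in> V" "\<phi> p = \<psi> q" for U V \<phi> \<psi> p q
  proof -
    obtain T where "frechet_derivative (x \<circ> \<phi>) (at p) = frechet_derivative (x \<circ> \<psi>) (at q) \<circ> T"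
      using chart_derivative[OF A c] .
    then show ?thesis by (auto simp: tangent_plane_def)
  qed
  from this[OF charts pq] this[OF charts(2,1) pq(2,1) pq(3)[symmetric]] show ?thesis by (rule equalityI)
qed

lemma adapted_frame_chart:
  assumes A: "oriented_surface A" "immersion A x"
    and charts: "(U, \<phi>) \<in> A" "(V, \<psi>) \<in> A" and pq: "p \<in> U" "q \<in> V" "\<phi> p = \<psi> q"
    and e: "adapted_frame (x \<circ> \<phi>) p e"
  shows "adapted_frame (x \<circ> \<psi>) q e"
proof -
  obtain T where T: "linear T" "det (matrix T) > 0"
    "frechet_derivative (x \<circ> \<phi>) (at p) = frechet_derivative (x \<circ> \<psi>) (at q) \<circ> T"
    using chart_derivative[OF A charts pq] .
  obtain w :: "real^2^2" where w: "det w > 0" "e 1 = frechet_derivative (x \<circ> \<phi>) (at p) (w$1)"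
    "e 2 = frechet_derivative (x \<circ> \<phi>) (at p) (w$2)"
    using e by (auto simp: adapted_frame_def)
  \<comment> \<open>The coordinate vectors are the rows of \<open>w\<close>, hence the transpose; a
    positive determinant is preserved.\<close>
  define w' :: "real^2^2" where "w' = w ** transpose (matrix T)"
  have "w' $ i = T (w $ i)" for i
  proof -
    have "T (w $ i) = matrix T *v (w $ i)" by (simp add: matrix_works[OF T(1)[folded linear_matrix_vector_mul_eq]])
    then show ?thesis
      by (simp add: w'_def vec_eq_iff matrix_matrix_mult_def matrix_vector_mult_def transpose_def mult.commute)
  qed
  then have "e 1 = frechet_derivative (x \<circ> \<psi>) (at q) (w'$1)" "e 2 = frechet_derivative (x \<circ> \<psi>) (at q) (w'$2)"
    using w T(3) by simp_all
  moreover have "det w' > 0" using w(1) T(2) by (simp add: w'_def det_mul det_transpose)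
  moreover have "normal_plane (x \<circ> \<phi>) p = normal_plane (x \<circ> \<psi>) q"
    unfolding normal_plane_def tangent_plane_chart[OF A charts pq] ..
  ultimately show ?thesis using e by (auto simp: adapted_frame_def)
qed

text \<open>The description in \<open>gauss_map\<close> ranges over all charts through the point.
  Each frame is moved to the given chart by \<open>adapted_frame_chart\<close>, where
  \<open>wedge_eq_gauss\<close> fixes the bivector.\<close>

lemma gauss_map_chart:
  assumes A: "oriented_surface A" "immersion A x"
    and chart: "(U, \<phi>) \<in> A" and frame: "framed_surface (x \<circ> \<phi>) U e1 e2" and p: "p \<in> U"
  shows "gauss_map A x (\<phi> p) = framed_surface.gauss (x \<circ> \<phi>) e1 e2 p"
proof -
  interpret framed_surface "x \<circ> \<phi>" U e1 e2 by (rule frame)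
  obtain e where e: "adapted_frame (x \<circ> \<phi>) p e" using adapted_frame_exists[OF p] .
  show ?thesis
    unfolding gauss_map_def
  proof (rule the_equality)
    show "\<exists>(V, \<psi>)\<in>A. \<exists>q\<in>V. \<exists>e. \<psi> q = \<phi> p \<and> adapted_frame (x \<circ> \<psi>) q e \<and> gauss p = e 3 \<and>\<^sub>E e 4"
      by (rule bexI[OF _ chart]) (use p e wedge_eq_gauss[OF p e, symmetric] in auto)
  next
    fix \<nu> assume "\<exists>(V, \<psi>)\<in>A. \<exists>q\<in>V. \<exists>e. \<psi> q = \<phi> p \<and> adapted_frame (x \<circ> \<psi>) q e \<and> \<nu> = e 3 \<and>\<^sub>E e 4"
    then obtain V \<psi> q e where "(V, \<psi>) \<in> A" "q \<in> V" "\<psi> q = \<phi> p" "adapted_frame (x \<circ> \<psi>) q e" "\<nu> = e 3 \<and>\<^sub>E e 4"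
      by blast
    then show "\<nu> = gauss p"
      using wedge_eq_gauss[OF p adapted_frame_chart[OF A _ chart _ p]] by blast
  qed
qed

lemma ball_pair_iff_conj:
  assumes "\<And>u v. (u, v) \<in> A \<Longrightarrow> P u v \<longleftrightarrow> Q u v \<and> R u v"
  shows "(\<forall>(u, v)\<in>A. P u v) \<longleftrightarrow> (\<forall>(u, v)\<in>A. Q u v) \<and> (\<forall>(u, v)\<in>A. R u v)"
  using assms by fast

theorem proposition3p5:
  fixes A :: "'m::{t2_space,second_countable_topology} atlas"
    and x :: "'m \<Rightarrow> real^4"
  assumes "oriented_maximal_surface A x"
  shows "harmonic A x (gauss_map A x) \<longleftrightarrow> flat_surface A x \<and> flat_normal_bundle A x"
proof -
  have A: "oriented_surface A" "immersion A x" "space_like A x"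
    and max: "\<And>U \<phi> p. (U, \<phi>) \<in> A \<Longrightarrow> p \<in> U \<Longrightarrow> mean_curv (x \<circ> \<phi>) p = 0"
    using assms unfolding oriented_maximal_surface_def by blast+
  \<comment> \<open>Harmonicity and both flatness conditions are imposed chart by chart, so one
    chart suffices.\<close>
  have chart: "(\<forall>p\<in>U. laplacian (x \<circ> \<phi>) (gauss_map A x \<circ> \<phi>) p = 0) \<longleftrightarrow>
      (\<forall>p\<in>U. gauss_curv (x \<circ> \<phi>) p = 0) \<and>
      (\<forall>V X Y \<xi>. open V \<and> V \<subseteq> U \<and> smooth_on X V \<and> smooth_on Y V \<and> smooth_on \<xi> V \<and>
        (\<forall>q\<in>V. \<xi> q \<in> normal_plane (x \<circ> \<phi>) q) \<longrightarrow> (\<forall>p\<in>V. normal_curvature (x \<circ> \<phi>) X Y \<xi> p = 0))"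
      (is "?harm \<longleftrightarrow> ?flat \<and> ?flat_normal")
    if c: "(U, \<phi>) \<in> A" for U \<phi>
  proof -
    have "open U" using A(1) c unfolding oriented_surface_def by blast
    moreover have "smooth_on (x \<circ> \<phi>) U" "\<And>p. p \<in> U \<Longrightarrow> inj (frechet_derivative (x \<circ> \<phi>) (at p))"
      using A(2) c unfolding immersion_def by blast+
    moreover have "\<And>p v. p \<in> U \<Longrightarrow> v \<in> tangent_plane (x \<circ> \<phi>) p \<Longrightarrow> v \<noteq> 0 \<Longrightarrow> mink v v > 0"
      using A(3) c unfolding space_like_def by blast
    ultimately obtain e1 e2 where frame: "framed_surface (x \<circ> \<phi>) U e1 e2"
      by (rule gram_schmidt_frame)
    interpret framed_surface "x \<circ> \<phi>" U e1 e2 by (rule frame)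
    \<comment> \<open>The Laplacian sees only the values on the open set \<open>U\<close>, where the
      description equals the smooth \<open>gauss\<close>.\<close>
    have "laplacian (x \<circ> \<phi>) (gauss_map A x \<circ> \<phi>) p = laplacian (x \<circ> \<phi>) gauss p" if "p \<in> U" for p
      by (rule laplacian_cong_open[OF open_U that]) (simp add: gauss_map_chart[OF A(1,2) c frame])
    then have "?harm \<longleftrightarrow> ?flat \<and> (\<forall>p\<in>U. dual (h11 p) (h12 p) = 0)"
      using laplacian_gauss_eq_0_iff[OF _ max[OF c]] by auto
    moreover have "?flat_normal \<longleftrightarrow> (\<forall>p\<in>U. dual (h11 p) (h12 p) = 0)"
      by (rule normal_curvature_vanishes_iff[OF max[OF c]])
    ultimately show ?thesis by blast
  qed
  show ?thesis
    unfolding harmonic_def flat_surface_def flat_normal_bundle_def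
    by (rule ball_pair_iff_conj) (rule chart)
qed

end
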